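(* Let $0<\epsilon <1/2$ and let $U,V$ be finite subsets of $\mathbb{Z}$ with $N=\min \{|U|, |V|\}\ge 3$ and $M=\max\{|U|,|V|\}\geq 2/\sqrt{\epsilon}$. Let $\Gamma \subset U\times V$ with $|\Gamma|\ge (1-\epsilon)|U||V|$ and write $|U\stackrel{\Gamma}{+} V|= |U|+|V|+r$. If \[r<\frac{N}{2}-13\sqrt{\epsilon}M,\] then there are arithmetic progressions $P$ and $Q$ with the same common difference and lengths $|P|\le |U|+r+5\sqrt{\epsilon}M$, $|Q|\le |V|+r+5\sqrt{\epsilon}M$, such that $|P\cap U|\ge (1-\sqrt{\epsilon})|U|$ and $|Q\cap V|\ge (1-\sqrt{\epsilon})|V|$.
   Context: For $U,V$ subsets of an abelian group and $\Gamma\subset U\times V$, the restricted sumset is $U\stackrel{\Gamma}{+} V=\{u+v: (u,v)\in \Gamma\}$. *)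

theory Defs
  imports Complex_Main
begin

definition restricted_sumset :: "('a::ab_group_add \<times> 'a) set \<Rightarrow> 'a set" where
  "restricted_sumset \<Gamma> = {u + v | u v. (u, v) \<in> \<Gamma>}"

text \<open>Finite progressions in the integers. The common difference is nonzero, so the length
  \<open>n\<close> of the progression is the cardinality of \<open>P\<close>.\<close>

definition arith_progression :: "int \<Rightarrow> int set \<Rightarrow> bool" where
  "arith_progression d P \<longleftrightarrow> d \<noteq> 0 \<and> (\<exists>a (n::nat). P = {a + int i * d | i. i < n})"

end

theory Submission
  imports Defs
begin

text \<open>
  Deleting the vertices that miss more than a proportion \<open>sqrt \<epsilon>\<close> of the other side leaves sets \<open>A\<close> and
  \<open>B\<close> in which every vertex is joined to almost everything; it suffices to cover these. Say that the
  diameter \<open>q\<close> of \<open>A\<close> is at least that of \<open>B\<close>. As in the Lev--Smeliansky proof of Freiman's \<open>3k - 4\<close>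
  theorem, reduce modulo \<open>q\<close>: about \<open>card B\<close> residues are hit twice, so the sumset has at most
  \<open>card A + N / 2\<close> residues, up to an error of order \<open>sqrt \<epsilon> * M\<close>. Only few sums with at least
  \<open>t = \<lceil>sqrt \<epsilon> * M\<rceil>\<close> representations are lost in the restricted sumset, so Kneser's theorem can be
  replaced by an Olson-type bound for popular sums, proved with the Dyson transform: either
  \<open>\<Sum>g. min t (r g)\<close> is at least \<open>t (card A + card B / 2 - 3 t / 2)\<close>, or a set of popular sums is
  periodic modulo a subgroup \<open>H\<close> and almost all of \<open>B\<close> lies in one coset of \<open>H\<close>. If \<open>H\<close> is proper,
  counting sums in the integers coset by coset gives a contradiction; otherwise almost all residues
  are hit, which bounds \<open>q\<close>. Reducing modulo the diameter of \<open>B\<close> and using the pigeonhole principle,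
  now that \<open>A\<close> is dense in a progression, bounds the diameter of \<open>B\<close>.
\<close>

section \<open>Popular sums in abelian groups\<close>

definition reps :: "'a::ab_group_add set \<Rightarrow> 'a set \<Rightarrow> 'a \<Rightarrow> nat" where
  "reps A B g = card {p \<in> A \<times> B. fst p + snd p = g}"

text \<open>The quantity bounded in Pollard's theorem: the sum over \<open>i = 1..t\<close> of the
  number of elements with at least \<open>i\<close> representations.\<close>

definition pollard_sum :: "nat \<Rightarrow> 'a::ab_group_add set \<Rightarrow> 'a set \<Rightarrow> nat" where
  "pollard_sum t A B = (\<Sum>g\<in>(\<lambda>p. fst p + snd p) ` (A \<times> B). min t (reps A B g))"

lemma sum_le_pollard_sum:
  assumes "finite A" "finite B" "finite W"
  shows "(\<Sum>g\<in>W. min t (reps A B g)) \<le> pollard_sum t A B"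
proof -
  let ?S = "(\<lambda>p. fst p + snd p) ` (A \<times> B)"
  have z: "reps A B g = 0" if "g \<notin> ?S" for g
  proof -
    have "{p \<in> A \<times> B. fst p + snd p = g} = {}" using that by blast
    then show ?thesis unfolding reps_def by (metis card.empty)
  qed
  have "(\<Sum>g\<in>W. min t (reps A B g)) = (\<Sum>g\<in>W \<inter> ?S. min t (reps A B g))"
    by (rule sum.mono_neutral_right) (use assms z in auto)
  also have "\<dots> \<le> (\<Sum>g\<in>?S. min t (reps A B g))"
    by (rule sum_mono2) (use assms in auto)
  finally show ?thesis unfolding pollard_sum_def .
qed

text \<open>The common tool for lower bounds. By injectivity \<open>g\<close> is the sum of at most
  one pair in each \<open>J m\<close>, and by disjointness different \<open>m\<close> give different
  pairs, so \<open>g\<close> is counted at most \<open>min t (reps A B g)\<close> times.\<close>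

lemma sum_card_family_le:
  fixes J :: "'m \<Rightarrow> ('a::ab_group_add \<times> 'a) set"
  assumes "finite A" "finite B" "finite W" "finite I" "card I \<le> t"
    and sub: "\<And>m. m \<in> I \<Longrightarrow> J m \<subseteq> A \<times> B"
    and inj: "\<And>m. m \<in> I \<Longrightarrow> inj_on (\<lambda>p. fst p + snd p) (J m)"
    and W: "\<And>m p. m \<in> I \<Longrightarrow> p \<in> J m \<Longrightarrow> fst p + snd p \<in> W"
    and disj: "\<And>m n. m \<in> I \<Longrightarrow> n \<in> I \<Longrightarrow> m \<noteq> n \<Longrightarrow> J m \<inter> J n = {}"
  shows "(\<Sum>m\<in>I. card (J m)) \<le> (\<Sum>g\<in>W. min t (reps A B g))"
proof -
  let ?s = "\<lambda>p::'a \<times> 'a. fst p + snd p"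
  have "(\<Sum>m\<in>I. card (J m)) = (\<Sum>m\<in>I. \<Sum>g\<in>W. if g \<in> ?s ` J m then 1 else 0)"
  proof (rule sum.cong[OF refl])
    fix m assume m: "m \<in> I"
    have "card (J m) = card (?s ` J m)" using inj[OF m] by (simp add: card_image)
    also have "?s ` J m = {g \<in> W. g \<in> ?s ` J m}" using W[OF m] by auto
    also have "card \<dots> = (\<Sum>g\<in>W. if g \<in> ?s ` J m then 1 else 0)"
      using \<open>finite W\<close> by (simp add: sum.If_cases Int_def)
    finally show "card (J m) = \<dots>" .
  qed
  also have "\<dots> = (\<Sum>g\<in>W. \<Sum>m\<in>I. if g \<in> ?s ` J m then 1 else 0)"
    by (rule sum.swap)
  also have "\<dots> \<le> (\<Sum>g\<in>W. min t (reps A B g))"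
  proof (rule sum_mono)
    fix g assume "g \<in> W"
    let ?I = "{m \<in> I. g \<in> ?s ` J m}"
    have e: "(\<Sum>m\<in>I. if g \<in> ?s ` J m then 1 else 0) = card ?I"
      using \<open>finite I\<close> by (simp add: sum.If_cases Int_def)
    have "card ?I \<le> card I" using \<open>finite I\<close> by (intro card_mono) auto
    moreover have "card ?I \<le> reps A B g"
    proof -
      have "\<forall>m\<in>?I. \<exists>p. p \<in> J m \<and> ?s p = g" by blast
      then obtain c where c: "\<And>m. m \<in> ?I \<Longrightarrow> c m \<in> J m \<and> ?s (c m) = g" by metis
      have "inj_on c ?I"
      proof (rule inj_onI)
        fix m n assume mn: "m \<in> ?I" "n \<in> ?I" "c m = c n"
        then have "c m \<in> J m \<inter> J n" using c[of m] c[of n] by auto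
        then show "m = n" using disj[of m n] mn by auto
      qed
      moreover have "c ` ?I \<subseteq> {p \<in> A \<times> B. ?s p = g}"
      proof
        fix p assume "p \<in> c ` ?I"
        then obtain m where "m \<in> ?I" "p = c m" by blast
        then show "p \<in> {p \<in> A \<times> B. ?s p = g}" using c[of m] sub[of m] by blast
      qed
      ultimately show ?thesis unfolding reps_def
        using assms(1,2) by (intro card_inj_on_le) auto
    qed
    ultimately show "(\<Sum>m\<in>I. if g \<in> ?s ` J m then 1 else 0) \<le> min t (reps A B g)"
      using e \<open>card I \<le> t\<close> by simp
  qed
  finally show ?thesis .
qed

lemma sum_card_family_le_pollard_sum:
  fixes J :: "'m \<Rightarrow> ('a::ab_group_add \<times> 'a) set"
  assumes "finite A" "finite B" "finite I" "card I \<le> t"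
    and "\<And>m. m \<in> I \<Longrightarrow> J m \<subseteq> A \<times> B"
    and "\<And>m. m \<in> I \<Longrightarrow> inj_on (\<lambda>p. fst p + snd p) (J m)"
    and "\<And>m n. m \<in> I \<Longrightarrow> n \<in> I \<Longrightarrow> m \<noteq> n \<Longrightarrow> J m \<inter> J n = {}"
  shows "(\<Sum>m\<in>I. card (J m)) \<le> pollard_sum t A B"
  unfolding pollard_sum_def
proof (rule sum_card_family_le[OF assms(1,2) _ assms(3-6) _ assms(7)])
  fix m p assume "m \<in> I" "p \<in> J m"
  then have "p \<in> A \<times> B" using assms(5) by blast
  then show "fst p + snd p \<in> (\<lambda>p. fst p + snd p) ` (A \<times> B)" by (rule imageI)
qed (use assms in auto)

lemma pollard_sum_ge_card:
  fixes A B :: "'a::ab_group_add set"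
  assumes "finite A" "finite B" "t \<le> card B"
  shows "t * card A \<le> pollard_sum t A B"
proof -
  obtain B0 where B0: "B0 \<subseteq> B" "card B0 = t" "finite B0"
    using assms(3) obtain_subset_with_card_n by metis
  have "(\<Sum>b\<in>B0. card (A \<times> {b})) \<le> pollard_sum t A B"
    by (rule sum_card_family_le_pollard_sum) (use assms B0 in \<open>auto simp: inj_on_def\<close>)
  then show ?thesis using B0 by (simp add: card_cartesian_product)
qed

section \<open>Translates inside a set and terminal pairs\<close>

lemma card_Diff_translate:
  fixes A E :: "'a::ab_group_add set"
  assumes "finite A" "\<And>e. e \<in> E \<Longrightarrow> e + b \<in> A"
  shows "card {x \<in> A. x - b \<notin> E} + card E = card A"
proof -
  have inj: "inj_on (\<lambda>e. e + b) E" by (auto simp: inj_on_def)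
  have sub: "(\<lambda>e. e + b) ` E \<subseteq> A" using assms by auto
  have "{x \<in> A. x - b \<notin> E} = A - (\<lambda>e. e + b) ` E"
  proof (intro set_eqI iffI)
    fix x assume x: "x \<in> {x \<in> A. x - b \<notin> E}"
    then have "x \<noteq> e + b" if "e \<in> E" for e using that by auto
    then show "x \<in> A - (\<lambda>e. e + b) ` E" using x by auto
  next
    fix x assume x: "x \<in> A - (\<lambda>e. e + b) ` E"
    have "x - b \<notin> E"
    proof
      assume "x - b \<in> E"
      then have "(x - b) + b \<in> (\<lambda>e. e + b) ` E" by (rule imageI)
      then show False using x by simp
    qed
    then show "x \<in> {x \<in> A. x - b \<notin> E}" using x by auto
  qed
  then have "card {x \<in> A. x - b \<notin> E} = card A - card ((\<lambda>e. e + b) ` E)"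
    using sub assms(1) by (simp add: card_Diff_subset finite_subset)
  moreover have "card ((\<lambda>e. e + b) ` E) = card E" using inj by (simp add: card_image)
  moreover have "card ((\<lambda>e. e + b) ` E) \<le> card A" using sub assms(1) by (intro card_mono)
  ultimately show ?thesis by simp
qed

text \<open>Averaging over pairs \<open>(x, b')\<close> with \<open>x - b + b'\<close> outside
  \<open>A\<close>: each \<open>x\<close> in \<open>Y\<close> gives at least
  \<open>card R - t\<close> of them and \<open>card R \<le> 2 * card Y\<close>, so some
  \<open>b'\<close> has at least half of \<open>card R - t\<close>.\<close>

lemma exists_expanding_translate:
  fixes A R Y :: "'a::ab_group_add set"
  assumes "finite A" "finite R" "R \<noteq> {}"
    and Y: "Y \<subseteq> A" "\<And>x. x \<in> Y \<Longrightarrow> card {b' \<in> R. x - b + b' \<in> A} < t"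
    and big: "card R \<le> 2 * card Y"
  shows "\<exists>b'\<in>R. card R \<le> 2 * card {x \<in> A. x - b + b' \<notin> A} + t"
proof (rule ccontr)
  assume "\<not> ?thesis"
  then have neg: "\<And>b'. b' \<in> R \<Longrightarrow> 2 * card {x \<in> A. x - b + b' \<notin> A} < card R - t" by force
  have "(\<Sum>b'\<in>R. card {x \<in> A. x - b + b' \<notin> A}) = (\<Sum>x\<in>A. card {b' \<in> R. x - b + b' \<notin> A})"
  proof -
    have "(\<Sum>b'\<in>R. card {x \<in> A. x - b + b' \<notin> A}) = (\<Sum>b'\<in>R. \<Sum>x\<in>A. if x - b + b' \<notin> A then 1 else 0)"
      using assms(1) by (intro sum.cong refl) (simp add: sum.If_cases Int_def)
    also have "\<dots> = (\<Sum>x\<in>A. \<Sum>b'\<in>R. if x - b + b' \<notin> A then 1 else 0)" by (rule sum.swap)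
    also have "\<dots> = (\<Sum>x\<in>A. card {b' \<in> R. x - b + b' \<notin> A})"
      using assms(2) by (intro sum.cong refl) (simp add: sum.If_cases Int_def)
    finally show ?thesis .
  qed
  moreover have "\<dots> \<ge> (\<Sum>x\<in>Y. card {b' \<in> R. x - b + b' \<notin> A})"
    using assms by (intro sum_mono2) auto
  moreover have "(\<Sum>x\<in>Y. card {b' \<in> R. x - b + b' \<notin> A}) \<ge> (\<Sum>x\<in>Y. card R - t)"
  proof (rule sum_mono)
    fix x assume "x \<in> Y"
    have "card R = card ({b' \<in> R. x - b + b' \<in> A} \<union> {b' \<in> R. x - b + b' \<notin> A})"
      by (rule arg_cong[of _ _ card]) auto
    also have "\<dots> \<le> card {b' \<in> R. x - b + b' \<in> A} + card {b' \<in> R. x - b + b' \<notin> A}"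
      by (rule card_Un_le)
    finally show "card R - t \<le> card {b' \<in> R. x - b + b' \<notin> A}" using Y(2)[OF \<open>x \<in> Y\<close>] by simp
  qed
  ultimately have ge: "card Y * (card R - t) \<le> (\<Sum>b'\<in>R. card {x \<in> A. x - b + b' \<notin> A})" by simp
  have "2 * (\<Sum>b'\<in>R. card {x \<in> A. x - b + b' \<notin> A}) < (\<Sum>b'\<in>R. card R - t)"
    unfolding sum_distrib_left using assms neg by (intro sum_strict_mono) auto
  also have "\<dots> = card R * (card R - t)" by simp
  also have "\<dots> \<le> (2 * card Y) * (card R - t)" using big by (rule mult_le_mono1)
  finally show False using ge by linarith
qed

text \<open>A greedy choice gives \<open>t\<close> disjoint pairs \<open>(b, b')\<close> in \<open>B\<close> for which the union of \<open>A + b\<close> and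
  \<open>A + b'\<close> has at least \<open>card A + k\<close> elements.\<close>

lemma pollard_sum_ge_of_pairs:
  fixes A B :: "'a::ab_group_add set"
  assumes "finite A" "finite B" "2 * t \<le> card B"
    and step: "\<And>b R. b \<in> B \<Longrightarrow> R \<subseteq> B \<Longrightarrow> R \<noteq> {} \<Longrightarrow> card B \<le> card R + 2 * t
      \<Longrightarrow> \<exists>b'\<in>R. k \<le> card {x \<in> A. x - b + b' \<notin> A}"
  shows "t * (card A + k) \<le> pollard_sum t A B"
proof -
  let ?P = "\<lambda>I. I \<subseteq> B \<times> B \<and> inj_on fst I \<and> inj_on snd I \<and> fst ` I \<inter> snd ` I = {}
     \<and> (\<forall>m\<in>I. k \<le> card {x \<in> A. x - fst m + snd m \<notin> A})"
  have ex: "n \<le> t \<Longrightarrow> \<exists>I. finite I \<and> card I = n \<and> ?P I" for n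
  proof (induction n)
    case 0
    show ?case by (rule exI[of _ "{}"]) auto
  next
    case (Suc n)
    then obtain I where I: "finite I" "card I = n" "?P I" by auto
    let ?U = "fst ` I \<union> snd ` I"
    have cU: "card ?U \<le> 2 * n"
      using card_Un_le[of "fst ` I" "snd ` I"] card_image_le[OF I(1), of fst]
        card_image_le[OF I(1), of snd] I(2) by linarith
    have UB: "?U \<subseteq> B" using I(3) by auto
    have "card (B - ?U) = card B - card ?U"
      using UB assms(2) by (intro card_Diff_subset) (auto intro: finite_subset)
    then have c1: "card (B - ?U) \<ge> card B - 2 * n" using cU by simp
    then have "card (B - ?U) > 0" using Suc.prems assms(3) by simp
    then obtain b where b: "b \<in> B - ?U" by (metis card_gt_0_iff ex_in_conv)
    \<comment> \<open>The \<open>n < t\<close> earlier pairs and \<open>b\<close> use up at most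
      \<open>2 * n + 1\<close> elements of \<open>B\<close>, so at least
      \<open>card B - 2 * t\<close> remain, and at least one does because
      \<open>2 * t \<le> card B\<close>.\<close>
    let ?R = "B - ?U - {b}"
    have cR: "card ?R = card (B - ?U) - 1" using b assms(2) by simp
    have "card ?R > 0" using cR c1 Suc.prems assms(3) by simp
    then have "?R \<noteq> {}" by (metis card_gt_0_iff)
    moreover have "card B \<le> card ?R + 2 * t" using cR c1 Suc.prems by simp
    ultimately obtain b' where b': "b' \<in> ?R" "k \<le> card {x \<in> A. x - b + b' \<notin> A}"
      using step[of b ?R] b by blast
    have "(b, b') \<notin> I" using b by force
    then have "card (insert (b, b') I) = Suc n" using I by simp
    moreover have "?P (insert (b, b') I)" using I(3) b b' by (auto simp: inj_on_def; force)
    ultimately show ?case using I(1) by (intro exI[of _ "insert (b, b') I"]) simp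
  qed
  obtain I where I: "finite I" "card I = t" "?P I" using ex[OF order_refl] by (elim exE conjE) simp
  \<comment> \<open>\<open>A + fst m\<close> together with the part of \<open>A + snd m\<close>
    outside it: \<open>x + snd m\<close> lies in \<open>A + fst m\<close> exactly when
    \<open>x - fst m + snd m\<close> is in \<open>A\<close>. Hence the sums within one
    \<open>J m\<close> are distinct.\<close>
  define J where "J m = (A \<times> {fst m}) \<union> ({x \<in> A. x - fst m + snd m \<notin> A} \<times> {snd m})" for m
  have neq: "fst m \<noteq> snd n" if "m \<in> I" "n \<in> I" for m n using I(3) that by blast
  have "(\<Sum>m\<in>I. card (J m)) \<le> pollard_sum t A B"
  proof (rule sum_card_family_le_pollard_sum)
    fix m assume m: "m \<in> I"
    show "J m \<subseteq> A \<times> B" using I(3) m unfolding J_def by auto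
    show "inj_on (\<lambda>p. fst p + snd p) (J m)"
    proof (rule inj_onI)
      fix p q assume p: "p \<in> J m" and q: "q \<in> J m" and e: "fst p + snd p = fst q + snd q"
      have *: False if "x \<in> A" "y - fst m + snd m \<notin> A" "x + fst m = y + snd m" for x y
      proof -
        have "y - fst m + snd m = x" using that(3) by (simp add: algebra_simps)
        then show False using that by simp
      qed
      from p consider "fst p \<in> A" "snd p = fst m" | "fst p - fst m + snd m \<notin> A" "snd p = snd m"
        unfolding J_def by auto
      moreover from q consider "fst q \<in> A" "snd q = fst m" | "fst q - fst m + snd m \<notin> A" "snd q = snd m"
        unfolding J_def by auto
      ultimately show "p = q" using e *[of "fst p" "fst q"] *[of "fst q" "fst p"]
        by (metis add_right_cancel prod_eqI)
    qed
  next
    fix m n assume mn: "m \<in> I" "n \<in> I" "m \<noteq> n"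
    then have "fst m \<noteq> fst n" "snd m \<noteq> snd n" using I(3) by (auto simp: inj_on_def)
    then show "J m \<inter> J n = {}" using neq[OF mn(1,2)] neq[OF mn(2,1)] unfolding J_def by auto
  qed (use assms I in auto)
  moreover have "(\<Sum>m\<in>I. card A + k) \<le> (\<Sum>m\<in>I. card (J m))"
  proof (rule sum_mono)
    fix m assume m: "m \<in> I"
    have "card (J m) = card (A \<times> {fst m}) + card ({x \<in> A. x - fst m + snd m \<notin> A} \<times> {snd m})"
      unfolding J_def by (rule card_Un_disjoint) (use assms(1) neq[OF m m] in auto)
    then show "card A + k \<le> card (J m)" using I(3) m by (simp add: card_cartesian_product)
  qed
  ultimately show ?thesis using I(2) by simp
qed

text \<open>The pairs that the Dyson transform cannot shrink any further. With \<open>E\<close> the set of translates of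
  \<open>B\<close> inside \<open>A\<close>, the three cases are: \<open>E\<close> is almost as large as \<open>A\<close>, which makes it periodic; \<open>E\<close>
  misses much of \<open>A\<close>, so two translates of \<open>A\<close> by elements of \<open>B\<close> differ a lot; and an intermediate
  case, where \<open>t\<close> points \<open>x\<close> of \<open>A\<close> have most of \<open>x - b0 + B\<close> outside \<open>A\<close>.\<close>

lemma pollard_sum_terminal_pair:
  fixes A B :: "'a::ab_group_add set"
  assumes fin: "finite A" "finite B" and t: "1 \<le> t" "2 * t \<le> card B"
    and dich: "\<And>e. (\<forall>b\<in>B. e + b \<in> A) \<or> card {b \<in> B. e + b \<in> A} < t"
  shows "t * (2 * card A + card B) \<le> 2 * pollard_sum t A B + 3 * t * t \<or>
    (\<exists>E b0. b0 \<in> B \<and> finite E \<and> (\<forall>b\<in>B. \<forall>e\<in>E. e + (b - b0) \<in> E) \<and>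
       (\<forall>e\<in>E. e + b0 \<in> A) \<and> card A < card E + t)"
proof -
  define E where "E = {e. \<forall>b\<in>B. e + b \<in> A}"
  have "card B > 0" using t by simp
  then obtain b0 where b0: "b0 \<in> B" by (metis card_gt_0_iff ex_in_conv)
  have EA: "e + b \<in> A" if "e \<in> E" "b \<in> B" for e b using that unfolding E_def by auto
  have finE: "finite E"
  proof (rule finite_subset)
    show "E \<subseteq> (\<lambda>x. x - b0) ` A"
    proof
      fix e assume "e \<in> E"
      then have "e + b0 \<in> A" using EA b0 by simp
      then have "(e + b0) - b0 \<in> (\<lambda>x. x - b0) ` A" by (rule imageI)
      then show "e \<in> (\<lambda>x. x - b0) ` A" by simp
    qed
  qed (use fin in simp)
  \<comment> \<open>The number of points of \<open>A\<close> outside \<open>E + b\<close>; it does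
    not depend on \<open>b\<close> in \<open>B\<close>, since all these translates lie in
    \<open>A\<close>.\<close>
  define y where "y = card A - card E"
  have y: "card {x \<in> A. x - b \<notin> E} = y" "y + card E = card A" if "b \<in> B" for b
    using card_Diff_translate[of A E b] EA[OF _ that] fin unfolding y_def by auto
  have few: "card {b \<in> B. e + b \<in> A} < t" if "e \<notin> E" for e
    using dich[of e] that unfolding E_def by auto
  have cB: "card {b \<in> B. e + b \<in> A} + card {b \<in> B. e + b \<notin> A} = card B" for e
  proof -
    have "card ({b \<in> B. e + b \<in> A} \<union> {b \<in> B. e + b \<notin> A})
        = card {b \<in> B. e + b \<in> A} + card {b \<in> B. e + b \<notin> A}"
      by (rule card_Un_disjoint) (use fin in auto)
    moreover have "{b \<in> B. e + b \<in> A} \<union> {b \<in> B. e + b \<notin> A} = B" by auto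
    ultimately show ?thesis by simp
  qed
  consider "y < t" | "t \<le> y" "card B \<le> 2 * y" | "t \<le> y" "2 * y < card B" by linarith
  then show ?thesis
  proof cases
    case 1
    \<comment> \<open>If the shift left \<open>E\<close>, fewer than \<open>t\<close> elements
      \<open>b\<close> would put \<open>e + (b1 - b0) + b\<close> in \<open>A\<close>. But all
      except fewer than \<open>t\<close> do, because \<open>e + b - b0\<close> is then in
      \<open>E\<close> and adding \<open>b1\<close> lands in \<open>A\<close>. This contradicts
      \<open>2 * t \<le> card B\<close>.\<close>
    have "e + (b1 - b0) \<in> E" if e: "e \<in> E" and b1: "b1 \<in> B" for e b1
    proof (rule ccontr)
      assume n: "e + (b1 - b0) \<notin> E"
      have "card {b \<in> B. e + b - b0 \<notin> E} \<le> card {x \<in> A. x - b0 \<notin> E}"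
        by (rule card_inj_on_le[of "\<lambda>b. e + b"]) (use fin EA e in \<open>auto simp: inj_on_def\<close>)
      then have lt: "card {b \<in> B. e + b - b0 \<notin> E} < t" using y[OF b0] 1 by simp
      have "{b \<in> B. e + (b1 - b0) + b \<notin> A} \<subseteq> {b \<in> B. e + b - b0 \<notin> E}"
      proof
        fix b assume b: "b \<in> {b \<in> B. e + (b1 - b0) + b \<notin> A}"
        have "e + b - b0 \<notin> E"
        proof
          assume "e + b - b0 \<in> E"
          then have "e + b - b0 + b1 \<in> A" using EA b1 by simp
          moreover have "e + b - b0 + b1 = e + (b1 - b0) + b" by (simp add: algebra_simps)
          ultimately show False using b by simp
        qed
        then show "b \<in> {b \<in> B. e + b - b0 \<notin> E}" using b by simp
      qed
      then have le: "card {b \<in> B. e + (b1 - b0) + b \<notin> A} \<le> card {b \<in> B. e + b - b0 \<notin> E}"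
        using fin by (intro card_mono) auto
      have "p + q = n \<Longrightarrow> p < t \<Longrightarrow> q \<le> m \<Longrightarrow> m < t \<Longrightarrow> 2 * t \<le> n \<Longrightarrow> False" for p q m n :: nat
        by linarith
      from this[OF cB few[OF n] le lt t(2)] show False .
    qed
    moreover have "card A < card E + t" using y(2)[OF b0] 1 by simp
    ultimately show ?thesis using b0 finE EA
      by (intro disjI2 exI[of _ E] exI[of _ b0] conjI ballI) simp_all
  next
    case 2
    \<comment> \<open>Half of \<open>card B - 3 * t\<close>, rounded up: the chosen pairs cost up to
      \<open>2 * t\<close> elements of \<open>B\<close> and the averaging loses another
      \<open>t\<close>.\<close>
    define k where "k = (card B - 3 * t + 1) div 2"
    have "t * (card A + k) \<le> pollard_sum t A B"
    proof (rule pollard_sum_ge_of_pairs[OF fin t(2)])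
      fix b R assume b: "b \<in> B" and R: "R \<subseteq> B" "R \<noteq> {}" "card B \<le> card R + 2 * t"
      have finR: "finite R" using R(1) fin(2) by (rule finite_subset)
      have "\<exists>b'\<in>R. card R \<le> 2 * card {x \<in> A. x - b + b' \<notin> A} + t"
      proof (rule exists_expanding_translate[OF fin(1) finR R(2)])
        show "{x \<in> A. x - b \<notin> E} \<subseteq> A" by auto
        show "card R \<le> 2 * card {x \<in> A. x - b \<notin> E}"
          using 2(2) y[OF b] card_mono[OF fin(2) R(1)] by simp
        fix x assume x: "x \<in> {x \<in> A. x - b \<notin> E}"
        have "card {b' \<in> R. x - b + b' \<in> A} \<le> card {b' \<in> B. x - b + b' \<in> A}"
          using R(1) fin by (intro card_mono) auto
        then show "card {b' \<in> R. x - b + b' \<in> A} < t" using few[of "x - b"] x by auto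
      qed
      then show "\<exists>b'\<in>R. k \<le> card {x \<in> A. x - b + b' \<notin> A}"
        using R(3) unfolding k_def by (elim bexE, intro bexI) auto
    qed
    then have "2 * t * (card A + k) \<le> 2 * pollard_sum t A B" by simp
    moreover have "card B \<le> 2 * k + 3 * t" unfolding k_def by linarith
    then have "t * (2 * card A + card B) \<le> t * (2 * card A + (2 * k + 3 * t))" by simp
    ultimately show ?thesis by (simp add: algebra_simps)
  next
    case 3
    let ?s = "\<lambda>p::'a \<times> 'a. fst p + snd p"
    \<comment> \<open>Sums are split by membership in \<open>b0 + A\<close>. Inside it,
      \<open>E + b0\<close> paired with \<open>t\<close> elements of \<open>B\<close> gives
      \<open>t * card E\<close>. Outside it, \<open>t\<close> points of \<open>A\<close> not in
      \<open>E + b0\<close> give at least \<open>card B - t\<close> sums each.\<close>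
    let ?W1 = "(\<lambda>x. b0 + x) ` A"
    let ?W2 = "?s ` (A \<times> B) - ?W1"
    let ?S = "\<lambda>W. \<Sum>g\<in>W. min t (reps A B g)"
    obtain B0 where B0: "B0 \<subseteq> B" "card B0 = t" "finite B0"
      using t obtain_subset_with_card_n[of t B] by auto
    obtain Y0 where Y0: "Y0 \<subseteq> {x \<in> A. x - b0 \<notin> E}" "card Y0 = t" "finite Y0"
      using 3(1) y(1)[OF b0] obtain_subset_with_card_n[of t "{x \<in> A. x - b0 \<notin> E}"] by auto
    have "t * card E = (\<Sum>b\<in>B0. card E)" using B0(2) by simp
    also have "\<dots> = (\<Sum>b\<in>B0. card ((\<lambda>e. e + b0) ` E \<times> {b}))"
      by (intro sum.cong refl) (simp add: card_cartesian_product card_image inj_on_def)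
    also have "\<dots> \<le> ?S ?W1"
    proof (rule sum_card_family_le)
      fix b p assume b: "b \<in> B0" and p: "p \<in> (\<lambda>e. e + b0) ` E \<times> {b}"
      then obtain e where e: "e \<in> E" "p = (e + b0, b)" by auto
      have "b0 + (e + b) \<in> ?W1" using EA e(1) B0 b by (intro imageI) auto
      then show "?s p \<in> ?W1" using e(2) by (simp add: algebra_simps)
    qed (use fin B0 EA b0 in \<open>auto simp: inj_on_def\<close>)
    finally have s1: "t * card E \<le> ?S ?W1" .
    have "t * (card B - t) = (\<Sum>x\<in>Y0. card B - t)" using Y0(2) by simp
    also have "\<dots> \<le> (\<Sum>x\<in>Y0. card ({x} \<times> {b \<in> B. x - b0 + b \<notin> A}))"
    proof (rule sum_mono)
      fix x assume "x \<in> Y0"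
      then have "card {b \<in> B. x - b0 + b \<in> A} < t" using few Y0(1) by auto
      then show "card B - t \<le> card ({x} \<times> {b \<in> B. x - b0 + b \<notin> A})"
        using cB[of "x - b0"] by (simp add: card_cartesian_product)
    qed
    also have "\<dots> \<le> ?S ?W2"
    proof (rule sum_card_family_le)
      fix x p assume x: "x \<in> Y0" and p: "p \<in> {x} \<times> {b \<in> B. x - b0 + b \<notin> A}"
      then obtain b where b: "b \<in> B" "x - b0 + b \<notin> A" "p = (x, b)" by auto
      have "x + b \<notin> ?W1"
      proof
        assume "x + b \<in> ?W1"
        then obtain a where "a \<in> A" "x + b = b0 + a" by auto
        then have "a = x - b0 + b" by (simp add: algebra_simps)
        then show False using b \<open>a \<in> A\<close> by simp
      qed
      moreover have "?s (x, b) \<in> ?s ` (A \<times> B)" using Y0 x b by (intro imageI) auto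
      ultimately show "?s p \<in> ?W2" using b by simp
    qed (use fin Y0 in \<open>auto simp: inj_on_def\<close>)
    finally have s2: "t * (card B - t) \<le> ?S ?W2" .
    have "?S ?W1 + ?S ?W2 = ?S (?W1 \<union> ?W2)"
      by (rule sum.union_disjoint[symmetric]) (use fin in auto)
    also have "\<dots> \<le> pollard_sum t A B" by (rule sum_le_pollard_sum) (use fin in auto)
    finally have "t * card E + t * (card B - t) \<le> pollard_sum t A B" using s1 s2 by linarith
    then have "t * (2 * card E + 2 * (card B - t)) \<le> 2 * pollard_sum t A B" by (simp add: algebra_simps)
    moreover have "2 * card A + card B \<le> 2 * card E + 2 * (card B - t) + 3 * t"
      using y(2)[OF b0] 3(2) t by linarith
    then have "t * (2 * card A + card B) \<le> t * (2 * card E + 2 * (card B - t) + 3 * t)" by simp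
    ultimately show ?thesis by (simp add: algebra_simps)
  qed
qed

section \<open>The Dyson transform and the Olson-type bound\<close>

text \<open>The new sets are the union and the intersection of \<open>A - e\<close> and
  \<open>B\<close>. A pair \<open>(x, y)\<close> goes to \<open>(e + x, y)\<close> if
  \<open>e + x\<close> is in \<open>A\<close>, and otherwise to \<open>(e + y, x)\<close>. The
  branches cannot collide: \<open>e\<close> plus the second component is in \<open>A\<close> for the
  first and not in \<open>A\<close> for the second.\<close>

lemma reps_dyson_transform_le:
  fixes A B :: "'a::ab_group_add set"
  assumes "finite A" "finite B"
  shows "reps ((\<lambda>x. x - e) ` A \<union> B) {b \<in> B. e + b \<in> A} g \<le> reps A B (g + e)"
proof -
  let ?L = "{p \<in> ((\<lambda>x. x - e) ` A \<union> B) \<times> {b \<in> B. e + b \<in> A}. fst p + snd p = g}"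
  let ?R = "{p \<in> A \<times> B. fst p + snd p = g + e}"
  define h where "h p = (if e + fst p \<in> A then (e + fst p, snd p) else (e + snd p, fst p))"
    for p :: "'a \<times> 'a"
  have L: "fst p \<in> B \<or> e + fst p \<in> A" "snd p \<in> B" "e + snd p \<in> A" "fst p + snd p = g"
    if "p \<in> ?L" for p using that by auto
  have "card ?L \<le> card ?R"
  proof (rule card_inj_on_le[of h])
    show "inj_on h ?L"
    proof (rule inj_onI)
      fix p q assume p: "p \<in> ?L" and q: "q \<in> ?L" and hh: "h p = h q"
      show "p = q"
        using L(3)[OF p] L(3)[OF q] hh unfolding h_def
        by (auto simp: prod_eq_iff split: if_splits)
    qed
    show "h ` ?L \<subseteq> ?R"
    proof
      fix x assume "x \<in> h ` ?L"
      then obtain p where p: "p \<in> ?L" "x = h p" by blast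
      show "x \<in> ?R" using L[OF p(1)] p(2) unfolding h_def
        by (auto simp: algebra_simps split: if_splits)
    qed
    show "finite ?R" using assms by simp
  qed
  then show ?thesis unfolding reps_def .
qed

lemma pollard_sum_mono_reps:
  assumes "finite A" "finite B" "finite A'" "finite B'"
    and "\<And>g. reps A' B' g \<le> reps A B (g + z)"
  shows "pollard_sum t A' B' \<le> pollard_sum t A B"
proof -
  let ?S = "(\<lambda>p. fst p + snd p) ` (A' \<times> B')"
  have "pollard_sum t A' B' \<le> (\<Sum>g\<in>?S. min t (reps A B (g + z)))"
    unfolding pollard_sum_def by (rule sum_mono) (use assms(5) in \<open>simp add: min.coboundedI2\<close>)
  also have "\<dots> = (\<Sum>g\<in>(\<lambda>g. g + z) ` ?S. min t (reps A B g))"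
    by (subst sum.reindex) (auto simp: inj_on_def)
  also have "\<dots> \<le> pollard_sum t A B" by (rule sum_le_pollard_sum) (use assms in auto)
  finally show ?thesis .
qed

text \<open>A version of Olson's theorem (\<open>A + B\<close> is periodic modulo the subgroup generated by \<open>B\<close>, or has at
  least \<open>card A + card B / 2\<close> elements) for sums with at least \<open>t\<close> representations. In the periodic case
  for a transformed pair, \<open>t\<close> elements of \<open>B\<close> outside one coset of the stabiliser \<open>H\<close> would create a
  further, almost full coset of \<open>H\<close> outside the set \<open>F\<close> of popular sums.\<close>

lemma olson_pollard:
  fixes A B :: "'a::ab_group_add set"
  assumes fin: "finite A" "finite B" and t: "1 \<le> t" "t \<le> card A" "t \<le> card B"
  shows "t * (2 * card A + card B) \<le> 2 * pollard_sum t A B + 3 * t * t \<or>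
    (\<exists>H F b0. b0 \<in> B \<and> 0 \<in> H \<and> (\<forall>x\<in>H. \<forall>y\<in>H. x - y \<in> H) \<and>
       finite F \<and> F \<noteq> {} \<and> (\<forall>f\<in>F. \<forall>h\<in>H. f + h \<in> F) \<and>
       card {b \<in> B. b - b0 \<notin> H} < t \<and> (\<forall>g\<in>F. t \<le> reps A B g))"
proof -
  \<comment> \<open>Invariant of repeated Dyson transforms: \<open>z\<close> is the accumulated
    shift, and the second set keeps at least \<open>t\<close> elements. A triple with the smallest
    second set is terminal.\<close>
  define Inv where "Inv = (\<lambda>(A', B', z). finite A' \<and> B' \<subseteq> B \<and> (\<forall>x\<in>A. x - z \<in> A')
      \<and> card A' + card B' = card A + card B \<and> t \<le> card B' \<and> (\<forall>g. reps A' B' g \<le> reps A B (g + z)))"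
  have "Inv (A, B, 0)" unfolding Inv_def using fin t by simp
  then obtain T where T: "Inv T" and Tmin: "\<And>T'. Inv T' \<Longrightarrow> card (fst (snd T)) \<le> card (fst (snd T'))"
    using ex_has_least_nat[of Inv "(A, B, 0)" "\<lambda>T. card (fst (snd T))"] by blast
  obtain A' B' z where Teq: "T = (A', B', z)" by (cases T) auto
  have I: "finite A'" "B' \<subseteq> B" "\<And>x. x \<in> A \<Longrightarrow> x - z \<in> A'" "card A' + card B' = card A + card B"
    "t \<le> card B'" "\<And>g. reps A' B' g \<le> reps A B (g + z)"
    using T unfolding Inv_def Teq by auto
  have finB': "finite B'" using I(2) fin(2) by (rule finite_subset)
  have dich: "(\<forall>b\<in>B'. e + b \<in> A') \<or> card {b \<in> B'. e + b \<in> A'} < t" for e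
  proof (rule ccontr)
    assume n: "\<not> ?thesis"
    let ?A = "(\<lambda>x. x - e) ` A' \<union> B'" and ?B = "{b \<in> B'. e + b \<in> A'}"
    have "?B \<subset> B'" using n by auto
    then have lt: "card ?B < card B'" using finB' by (rule psubset_card_mono[rotated])
    have "(\<lambda>x. x - e) ` A' \<inter> B' = ?B"
      by (auto intro!: image_eqI[of _ _ "e + _"] simp: algebra_simps)
    then have "card ((\<lambda>x. x - e) ` A') + card B' = card ?A + card ?B"
      using card_Un_Int[of "(\<lambda>x. x - e) ` A'" B'] I(1) finB' by simp
    moreover have "card ((\<lambda>x. x - e) ` A') = card A'" by (simp add: card_image inj_on_def)
    ultimately have c: "card ?A + card ?B = card A + card B" using I(4) by simp
    have "reps ?A ?B g \<le> reps A B (g + (z + e))" for g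
      using reps_dyson_transform_le[OF I(1) finB', of e g] I(6)[of "g + e"]
      by (simp add: add_ac)
    moreover have "x - (z + e) \<in> ?A" if "x \<in> A" for x
    proof -
      have "(x - z) - e \<in> (\<lambda>x. x - e) ` A'" using I(3)[OF that] by (rule imageI)
      then show ?thesis by (simp add: diff_diff_eq)
    qed
    ultimately have "Inv (?A, ?B, z + e)" unfolding Inv_def using c I n finB' by auto
    from Tmin[OF this] show False using lt Teq by simp
  qed
  have mono: "pollard_sum t A' B' \<le> pollard_sum t A B"
    by (rule pollard_sum_mono_reps[OF fin I(1) finB' I(6)])
  have triv: "t * card A' \<le> pollard_sum t A B"
    using pollard_sum_ge_card[OF I(1) finB' I(5)] mono by linarith
  have cB': "card B' \<le> card B" using I(2) fin(2) by (rule card_mono[rotated])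
  show ?thesis
  proof (cases "2 * t \<le> card B'")
    case False
    have "2 * card A + card B \<le> 2 * card A' + 3 * t" using False I(4) t(3) by linarith
    then have "t * (2 * card A + card B) \<le> t * (2 * card A' + 3 * t)" by simp
    then show ?thesis using triv by (simp add: algebra_simps)
  next
    case True
    from pollard_sum_terminal_pair[OF I(1) finB' t(1) True dich]
    show ?thesis
    proof
      assume a: "t * (2 * card A' + card B') \<le> 2 * pollard_sum t A' B' + 3 * t * t"
      have "2 * card A + card B \<le> 2 * card A' + card B'" using I(4) cB' by linarith
      then have "t * (2 * card A + card B) \<le> t * (2 * card A' + card B')" by simp
      then show ?thesis using a mono by linarith
    next
      assume "\<exists>E b0. b0 \<in> B' \<and> finite E \<and> (\<forall>b\<in>B'. \<forall>e\<in>E. e + (b - b0) \<in> E) \<and>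
       (\<forall>e\<in>E. e + b0 \<in> A') \<and> card A' < card E + t"
      then obtain E b0 where b0: "b0 \<in> B'" and finE: "finite E"
        and Eb: "\<forall>b\<in>B'. \<forall>e\<in>E. e + (b - b0) \<in> E"
        and EA: "\<forall>e\<in>E. e + b0 \<in> A'" and cE: "card A' < card E + t"
        by (elim exE conjE) (rule that; assumption)
      have "t \<le> card A'" using I(4) cB' t(2) by linarith
      then have "E \<noteq> {}" using cE by auto
      then obtain e0 where e0: "e0 \<in> E" by blast
      \<comment> \<open>The stabiliser of \<open>E\<close>. As \<open>E\<close> is finite, a shift
        mapping it into itself maps it onto itself, so \<open>H\<close> is closed under
        negation.\<close>
      define H where "H = {h. \<forall>e\<in>E. e + h \<in> E}"
      have neg: "- h \<in> H" if "h \<in> H" for h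
      proof -
        have "(\<lambda>e. e + h) ` E = E"
          by (rule endo_inj_surj[OF finE]) (use that in \<open>auto simp: H_def inj_on_def\<close>)
        then have surj: "\<And>e. e \<in> E \<Longrightarrow> e \<in> (\<lambda>e. e + h) ` E" by simp
        have "e + - h \<in> E" if "e \<in> E" for e
        proof -
          obtain e' where "e' \<in> E" "e = e' + h" using surj[OF \<open>e \<in> E\<close>] by blast
          then show ?thesis by simp
        qed
        then show ?thesis unfolding H_def by simp
      qed
      have H0: "0 \<in> H" unfolding H_def by simp
      have Hd: "x - y \<in> H" if "x \<in> H" "y \<in> H" for x y
      proof -
        have "e + x + (- y) \<in> E" if "e \<in> E" for e
          using neg[OF \<open>y \<in> H\<close>] \<open>x \<in> H\<close> that unfolding H_def by blast
        then show ?thesis unfolding H_def by (simp add: algebra_simps)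
      qed
      have HB: "b - b0 \<in> H" if "b \<in> B'" for b using bspec[OF Eb that] unfolding H_def by simp
      have EH: "e + h \<in> E" if "e \<in> E" "h \<in> H" for e h using that unfolding H_def by blast
      have finH: "finite H"
      proof (rule inj_on_finite[OF _ _ finE])
        show "inj_on (\<lambda>h. e0 + h) H" by (simp add: inj_on_def)
        show "(\<lambda>h. e0 + h) ` H \<subseteq> E" using EH e0 by auto
      qed
      have cH: "card B' \<le> card H"
        by (rule card_inj_on_le[of "\<lambda>b. b - b0"]) (use HB finH in \<open>auto simp: inj_on_def\<close>)
      \<comment> \<open>For \<open>e\<close> in \<open>E\<close> and every \<open>b\<close> in
        \<open>B'\<close>, periodicity puts \<open>e - (b - b0) + b0\<close> in \<open>A'\<close>,
        and adding \<open>b\<close> gives \<open>e + b0 + b0\<close>. So this element has at least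
        \<open>card B' \<ge> t\<close> representations; adding \<open>z\<close> returns to sums of
        \<open>A\<close> and \<open>B\<close>.\<close>
      define F where "F = (\<lambda>e. e + (b0 + b0 + z)) ` E"
      have finF: "finite F" unfolding F_def using finE by simp
      have FH: "f + h \<in> F" if "f \<in> F" "h \<in> H" for f h
      proof -
        obtain e where e: "e \<in> E" "f = e + (b0 + b0 + z)" using \<open>f \<in> F\<close> unfolding F_def by blast
        have "(e + h) + (b0 + b0 + z) \<in> F" unfolding F_def using EH[OF e(1) \<open>h \<in> H\<close>] by (rule imageI)
        then show ?thesis using e(2) by (simp add: algebra_simps)
      qed
      have pop: "t \<le> reps A B g" if "g \<in> F" for g
      proof -
        obtain e where e: "e \<in> E" "g = e + (b0 + b0 + z)" using \<open>g \<in> F\<close> unfolding F_def by blast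
        have "card B' \<le> reps A' B' (e + (b0 + b0))" unfolding reps_def
        proof (rule card_inj_on_le[of "\<lambda>b. ((e + - (b - b0)) + b0, b)"])
          show "(\<lambda>b. ((e + - (b - b0)) + b0, b)) ` B' \<subseteq> {p \<in> A' \<times> B'. fst p + snd p = e + (b0 + b0)}"
          proof
            fix p assume "p \<in> (\<lambda>b. ((e + - (b - b0)) + b0, b)) ` B'"
            then obtain b where b: "b \<in> B'" "p = ((e + - (b - b0)) + b0, b)" by blast
            have "(e + - (b - b0)) + b0 \<in> A'" using EA EH e(1) neg HB b(1) by blast
            then show "p \<in> {p \<in> A' \<times> B'. fst p + snd p = e + (b0 + b0)}"
              using b by (simp add: algebra_simps)
          qed
        qed (use I(1) finB' in \<open>auto simp: inj_on_def\<close>)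
        then show ?thesis using I(6)[of "e + (b0 + b0)"] I(5) e(2) by (simp add: add_ac)
      qed
      show ?thesis
      proof (cases "card {b \<in> B. b - b0 \<notin> H} < t")
        case True
        have "F \<noteq> {}" using e0 unfolding F_def by blast
        then show ?thesis using True b0 I(2) H0 Hd finF FH pop
          by (intro disjI2 exI[of _ H] exI[of _ F] exI[of _ b0] conjI ballI) auto
      next
        case False
        then obtain B2 where B2: "B2 \<subseteq> {b \<in> B. b - b0 \<notin> H}" "card B2 = t" "finite B2"
          using obtain_subset_with_card_n[of t "{b \<in> B. b - b0 \<notin> H}"] by auto
        \<comment> \<open>\<open>E + b0\<close> moved back by \<open>z\<close>. Since
          \<open>A - z\<close> lies in \<open>A'\<close>, at most \<open>card A' - card A\<close>
          points of \<open>?F1\<close> are missing from \<open>A\<close>.\<close>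
        let ?F1 = "(\<lambda>e. e + (b0 + z)) ` E"
        have cF1: "card ?F1 = card E" by (simp add: card_image inj_on_def)
        have cF: "card F = card E" unfolding F_def by (simp add: card_image inj_on_def)
        have "card (A - ?F1) \<le> card {x \<in> A'. x - b0 \<notin> E}"
        proof (rule card_inj_on_le[of "\<lambda>x. x - z"])
          show "(\<lambda>x. x - z) ` (A - ?F1) \<subseteq> {x \<in> A'. x - b0 \<notin> E}"
          proof
            fix y assume "y \<in> (\<lambda>x. x - z) ` (A - ?F1)"
            then obtain x where x: "x \<in> A" "x \<notin> ?F1" "y = x - z" by blast
            have "y - b0 \<notin> E"
            proof
              assume "y - b0 \<in> E"
              then have "(y - b0) + (b0 + z) \<in> ?F1" by (rule imageI)
              then show False using x by simp
            qed
            then show "y \<in> {x \<in> A'. x - b0 \<notin> E}" using x I(3) by simp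
          qed
        qed (use I(1) in \<open>auto simp: inj_on_def\<close>)
        moreover have "card {x \<in> A'. x - b0 \<notin> E} + card E = card A'"
          by (rule card_Diff_translate[OF I(1)]) (rule bspec[OF EA])
        moreover have "card A = card (A \<inter> ?F1) + card (A - ?F1)" "card ?F1 = card (?F1 \<inter> A) + card (?F1 - A)"
          using fin finE by (auto intro: card_Int_Diff)
        ultimately have cdiff: "card (?F1 - A) + card A \<le> card A'"
          using cF1 by (simp add: Int_commute)
        let ?S = "\<lambda>W. \<Sum>g\<in>W. min t (reps A B g)"
        let ?W = "(\<lambda>p. fst p + snd p) ` (A \<times> B) - F"
        \<comment> \<open>For each \<open>b\<close> in \<open>B2\<close>, some coset of
          \<open>H\<close> inside \<open>?F1\<close> is moved by \<open>b\<close> entirely outside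
          \<open>F\<close>; at least \<open>k\<close> of its points belong to
          \<open>A\<close>.\<close>
        define k where "k = card H - card (?F1 - A)"
        have "t * k = (\<Sum>b\<in>B2. k)" using B2(2) by simp
        also have "\<dots> \<le> (\<Sum>b\<in>B2. card ({x \<in> A. x + b \<notin> F} \<times> {b}))"
        proof (rule sum_mono)
          fix b assume b: "b \<in> B2"
          then have "b - b0 \<notin> H" using B2 by auto
          then obtain e where e: "e \<in> E" "e + (b - b0) \<notin> E" unfolding H_def by blast
          have out: "e + h + (b0 + z) + b \<notin> F" if h: "h \<in> H" for h
          proof
            assume "e + h + (b0 + z) + b \<in> F"
            then obtain e' where e': "e' \<in> E" "e + h + (b0 + z) + b = e' + (b0 + b0 + z)"
              unfolding F_def by blast
            have "e + (b - b0) = e' + (- h)" using e'(2)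
              by (simp add: algebra_simps)
            then show False using e(2) EH[OF e'(1) neg[OF h]] by simp
          qed
          let ?K = "(\<lambda>h. e + h + (b0 + z)) ` H"
          have "?K \<subseteq> ?F1" using EH[OF e(1)] by auto
          then have "?K - (?F1 - A) \<subseteq> {x \<in> A. x + b \<notin> F}" using out by auto
          then have "card (?K - (?F1 - A)) \<le> card {x \<in> A. x + b \<notin> F}"
            using fin by (intro card_mono) auto
          moreover have "card ?K - card (?F1 - A) \<le> card (?K - (?F1 - A))"
            using finE by (intro diff_card_le_card_Diff) auto
          moreover have "card ?K = card H" by (simp add: card_image inj_on_def)
          ultimately show "k \<le> card ({x \<in> A. x + b \<notin> F} \<times> {b})"
            unfolding k_def by (simp add: card_cartesian_product)
        qed
        also have "\<dots> \<le> ?S ?W"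
        proof (rule sum_card_family_le)
          fix b p assume b: "b \<in> B2" and p: "p \<in> {x \<in> A. x + b \<notin> F} \<times> {b}"
          then have "p \<in> A \<times> B" "fst p + snd p \<notin> F" using B2 by auto
          then show "fst p + snd p \<in> ?W" by blast
        qed (use fin B2 in \<open>auto simp: inj_on_def\<close>)
        finally have s2: "t * k \<le> ?S ?W" .
        have "t * card F = (\<Sum>g\<in>F. t)" by simp
        also have "\<dots> \<le> ?S F" by (rule sum_mono) (use pop in auto)
        finally have s1: "t * card F \<le> ?S F" .
        have "?S F + ?S ?W = ?S (F \<union> ?W)"
          by (rule sum.union_disjoint[symmetric]) (use fin finF in auto)
        also have "\<dots> \<le> pollard_sum t A B" by (rule sum_le_pollard_sum) (use fin finF in auto)
        finally have "t * (card E + k) \<le> pollard_sum t A B" using s1 s2 cF by (simp add: distrib_left)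
        \<comment> \<open>The trivial bound \<open>t * card A'\<close> is added because
          \<open>k\<close> gains only about \<open>card B' - (card A' - card A)\<close>; together
          they reach \<open>2 * card A + card B\<close> up to \<open>3 * t\<close>.\<close>
        then have "t * (card A' + (card E + k)) \<le> 2 * pollard_sum t A B"
          using triv by (simp add: distrib_left)
        moreover have "2 * card A + card B \<le> card A' + (card E + k) + 3 * t"
          using cdiff cH cE I(4) unfolding k_def by linarith
        then have "t * (2 * card A + card B) \<le> t * (card A' + (card E + k) + 3 * t)" by simp
        ultimately show ?thesis by (simp add: algebra_simps)
      qed
    qed
  qed
qed

section \<open>Reduction of integers modulo \<open>q\<close>\<close>

text \<open>The group of reals modulo 1 contains all cyclic groups, which gives a single type for the
  reductions modulo varying integers \<open>q\<close>.\<close>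

typedef circle = "{0..<1::real}"
  by (rule exI[of _ 0]) simp

setup_lifting type_definition_circle

lemma frac_add_int: "frac (x + of_int n) = frac x" for x :: real
  by (simp add: frac_def)

lemma frac_frac_add: "frac (frac x + y) = frac (x + y)" "frac (y + frac x) = frac (y + x)"
  for x y :: real
proof -
  have "frac x + y = (x + y) + of_int (- \<lfloor>x\<rfloor>)" by (simp add: frac_def)
  then show 1: "frac (frac x + y) = frac (x + y)" by (simp only: frac_add_int)
  show "frac (y + frac x) = frac (y + x)" using 1 by (simp only: add.commute)
qed

instantiation circle :: ab_group_add
begin

lift_definition zero_circle :: circle is 0 by simp
lift_definition plus_circle :: "circle \<Rightarrow> circle \<Rightarrow> circle" is "\<lambda>x y. frac (x + y)"
  by (simp add: frac_lt_1)
lift_definition minus_circle :: "circle \<Rightarrow> circle \<Rightarrow> circle" is "\<lambda>x y. frac (x - y)"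
  by (simp add: frac_lt_1)
lift_definition uminus_circle :: "circle \<Rightarrow> circle" is "\<lambda>x. frac (- x)"
  by (simp add: frac_lt_1)

instance
proof
  fix a b c :: circle
  show "a + b + c = a + (b + c)" by transfer (simp add: frac_frac_add add_ac)
  show "a + b = b + a" by transfer (simp add: add.commute)
  show "0 + a = a" by transfer (simp add: frac_eq)
  show "- a + a = 0" by transfer (simp add: frac_frac_add)
  show "a - b = a + - b" by transfer (simp add: frac_frac_add)
qed

end

lift_definition residue :: "int \<Rightarrow> int \<Rightarrow> circle" is "\<lambda>q x. frac (real_of_int x / real_of_int q)"
  by (simp add: frac_lt_1)

lemma residue_add: "residue q (x + y) = residue q x + residue q y"
  by transfer (simp add: frac_frac_add add_divide_distrib)

lemma residue_diff: "residue q (x - y) = residue q x - residue q y"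
proof -
  have "residue q (x - y) + residue q y = residue q x" using residue_add[of q "x - y" y] by simp
  then show ?thesis by (simp add: algebra_simps)
qed

lemma residue_eq_0_iff:
  assumes "q > 0" shows "residue q x = 0 \<longleftrightarrow> q dvd x"
proof -
  have "residue q x = 0 \<longleftrightarrow> real_of_int x / real_of_int q \<in> \<int>"
    by transfer (simp add: frac_eq_0_iff)
  also have "\<dots> \<longleftrightarrow> q dvd x"
  proof
    assume "real_of_int x / real_of_int q \<in> \<int>"
    then obtain k where "real_of_int x / real_of_int q = of_int k" by (auto elim: Ints_cases)
    then have "real_of_int x = of_int (k * q)" using assms by (simp add: field_simps)
    then show "q dvd x" by (metis dvd_triv_right of_int_eq_iff)
  next
    assume "q dvd x"
    then show "real_of_int x / real_of_int q \<in> \<int>" using assms by (auto elim!: dvdE)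
  qed
  finally show ?thesis .
qed

lemma residue_eq_iff:
  assumes "q > 0" shows "residue q x = residue q y \<longleftrightarrow> q dvd x - y"
  using residue_eq_0_iff[OF assms, of "x - y"] by (simp add: residue_diff)

lemma residue_eqD:
  assumes "q > 0" "residue q x = residue q y" "\<bar>x - y\<bar> < q" shows "x = y"
proof -
  have "q dvd x - y" using assms residue_eq_iff by blast
  then show ?thesis using assms(3) zdvd_imp_le[of q "\<bar>x - y\<bar>"] by (cases "x = y") auto
qed

text \<open>Bezout, one element of \<open>X\<close> at a time. Applied to the preimage of a subgroup
  of residues, it places the common difference in that preimage.\<close>

lemma Gcd_in_subgroup:
  fixes L :: "int set"
  assumes "finite X" "X \<subseteq> L" "0 \<in> L" "\<And>x y. x \<in> L \<Longrightarrow> y \<in> L \<Longrightarrow> x - y \<in> L"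
  shows "Gcd X \<in> L"
proof -
  have neg: "- x \<in> L" if "x \<in> L" for x using assms(4)[OF assms(3) that] by simp
  have add: "x + y \<in> L" if "x \<in> L" "y \<in> L" for x y using assms(4)[OF that(1) neg[OF that(2)]] by simp
  have natmult: "int n * x \<in> L" if "x \<in> L" for n x
    by (induction n) (use assms(3) add that in \<open>auto simp: algebra_simps\<close>)
  have mult: "k * x \<in> L" if "x \<in> L" for k x
    using natmult[OF that, of "nat k"] neg[OF natmult[OF that, of "nat (- k)"]] by (cases "k \<ge> 0") auto
  show ?thesis using assms(1,2)
  proof (induction X rule: finite_induct)
    case empty
    then show ?case using assms(3) by simp
  next
    case (insert x X)
    obtain a b where "a * x + b * Gcd X = gcd x (Gcd X)" using bezout_int by blast
    then show ?case using insert add mult by (metis Gcd_insert insert_subset)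
  qed
qed

section \<open>Almost complete bipartite graphs on sets of integers\<close>

lemma finite_restricted_sumset:
  assumes "finite \<Gamma>" shows "finite (restricted_sumset \<Gamma>)"
proof -
  have "restricted_sumset \<Gamma> = (\<lambda>(x, y). x + y) ` \<Gamma>"
    unfolding restricted_sumset_def by auto
  then show ?thesis using assms by simp
qed

lemma subset_progression:
  fixes A :: "int set"
  assumes "finite A" "d > 0" "\<And>x. x \<in> A \<Longrightarrow> d dvd x - Min A"
  shows "A \<subseteq> (\<lambda>k. Min A + int k * d) ` {..nat ((Max A - Min A) div d)}"
proof
  fix x assume x: "x \<in> A"
  obtain k where k: "x - Min A = d * k" using assms(3)[OF x] by (auto elim: dvdE)
  have b: "0 \<le> x - Min A" "x - Min A \<le> Max A - Min A" using x assms(1) by auto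
  have "0 \<le> k" using b(1) k assms(2) by (simp add: zero_le_mult_iff)
  moreover have "k \<le> (Max A - Min A) div d"
    using zdiv_mono1[OF b(2) assms(2)] k assms(2) by simp
  ultimately have "nat k \<le> nat ((Max A - Min A) div d)" "k = int (nat k)" by auto
  then show "x \<in> (\<lambda>k. Min A + int k * d) ` {..nat ((Max A - Min A) div d)}"
    using k by (intro image_eqI[of _ _ "nat k"]) (auto simp: mult.commute)
qed

text \<open>Here \<open>A\<close> and \<open>B\<close> play the role of the vertices of almost full degree in \<open>U\<close> and \<open>V\<close>, while \<open>u\<close>
  and \<open>v\<close> are the cardinalities of \<open>U\<close> and \<open>V\<close>, and \<open>w\<close> stands for \<open>sqrt \<epsilon> * M\<close>.\<close>

locale dense_sum_graph =
  fixes A B :: "int set" and \<Gamma> :: "(int \<times> int) set" and u v r w :: real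
  assumes finA: "finite A" and finB: "finite B" and sub: "\<Gamma> \<subseteq> A \<times> B"
    and row: "\<And>x. x \<in> A \<Longrightarrow> real (card {y \<in> B. (x, y) \<notin> \<Gamma>}) \<le> w"
    and col: "\<And>y. y \<in> B \<Longrightarrow> real (card {x \<in> A. (x, y) \<notin> \<Gamma>}) \<le> w"
    and total: "real (card (A \<times> B - \<Gamma>)) \<le> w * w"
    and cardA: "u - w \<le> real (card A)" and cardB: "v - w \<le> real (card B)"
    and cardS: "real (card (restricted_sumset \<Gamma>)) \<le> u + v + r"
    and r_lt: "r < u / 2 - 13 * w" "r < v / 2 - 13 * w"
    and w2: "2 \<le> w" and nonempty: "A \<noteq> {}" "B \<noteq> {}"
begin

lemma finite_sumset: "finite (restricted_sumset \<Gamma>)"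
  using finite_subset[OF sub] finA finB by (intro finite_restricted_sumset) simp

lemma in_sumset: "(x, y) \<in> \<Gamma> \<Longrightarrow> x + y \<in> restricted_sumset \<Gamma>"
  unfolding restricted_sumset_def by blast

section \<open>Sums along single rows and columns\<close>

definition row_sums where "row_sums x C = (\<lambda>y. x + y) ` {y \<in> C. (x, y) \<in> \<Gamma>}"
definition col_sums where "col_sums y C = (\<lambda>x. x + y) ` {x \<in> C. (x, y) \<in> \<Gamma>}"

lemma row_sums_subset: "row_sums x C \<subseteq> restricted_sumset \<Gamma>"
  unfolding row_sums_def using in_sumset by auto

lemma col_sums_subset: "col_sums y C \<subseteq> restricted_sumset \<Gamma>"
  unfolding col_sums_def using in_sumset by auto

lemma card_row_sums:
  assumes "x \<in> A" "C \<subseteq> B" shows "real (card C) - w \<le> real (card (row_sums x C))"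
proof -
  have "card C = card ({y \<in> C. (x, y) \<in> \<Gamma>} \<union> {y \<in> C. (x, y) \<notin> \<Gamma>})"
    by (rule arg_cong[of _ _ card]) auto
  also have "\<dots> \<le> card {y \<in> C. (x, y) \<in> \<Gamma>} + card {y \<in> C. (x, y) \<notin> \<Gamma>}" by (rule card_Un_le)
  also have "card {y \<in> C. (x, y) \<notin> \<Gamma>} \<le> card {y \<in> B. (x, y) \<notin> \<Gamma>}"
    using assms finB by (intro card_mono) auto
  finally have "card C \<le> card {y \<in> C. (x, y) \<in> \<Gamma>} + card {y \<in> B. (x, y) \<notin> \<Gamma>}" by simp
  moreover have "card (row_sums x C) = card {y \<in> C. (x, y) \<in> \<Gamma>}"
    unfolding row_sums_def by (simp add: card_image)
  ultimately show ?thesis using row[OF assms(1)] by linarith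
qed

lemma card_col_sums:
  assumes "y \<in> B" "C \<subseteq> A" shows "real (card C) - w \<le> real (card (col_sums y C))"
proof -
  have "card C = card ({x \<in> C. (x, y) \<in> \<Gamma>} \<union> {x \<in> C. (x, y) \<notin> \<Gamma>})"
    by (rule arg_cong[of _ _ card]) auto
  also have "\<dots> \<le> card {x \<in> C. (x, y) \<in> \<Gamma>} + card {x \<in> C. (x, y) \<notin> \<Gamma>}" by (rule card_Un_le)
  also have "card {x \<in> C. (x, y) \<notin> \<Gamma>} \<le> card {x \<in> A. (x, y) \<notin> \<Gamma>}"
    using assms finA by (intro card_mono) auto
  finally have "card C \<le> card {x \<in> C. (x, y) \<in> \<Gamma>} + card {x \<in> A. (x, y) \<notin> \<Gamma>}" by simp
  moreover have "card (col_sums y C) = card {x \<in> C. (x, y) \<in> \<Gamma>}"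
    unfolding col_sums_def by (simp add: card_image)
  ultimately show ?thesis using col[OF assms(1)] by linarith
qed

lemma finite_row_sums: "finite (row_sums x C)" and finite_col_sums: "finite (col_sums y C)"
  by (rule finite_subset[OF row_sums_subset finite_sumset],
      rule finite_subset[OF col_sums_subset finite_sumset])

text \<open>Used with \<open>x\<close> and \<open>y\<close> extreme in opposite directions, for
  instance \<open>Min A\<close> and \<open>Max B\<close>, where a coincidence leaves only the corner
  \<open>x + y\<close>.\<close>

lemma card_row_Int_col:
  assumes "\<And>a b. a \<in> C \<Longrightarrow> b \<in> D \<Longrightarrow> a + y = x + b \<Longrightarrow> b = y"
  shows "card (row_sums x D \<inter> col_sums y C) \<le> 1"
proof -
  have "row_sums x D \<inter> col_sums y C \<subseteq> {x + y}"
    unfolding row_sums_def col_sums_def using assms by fastforce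
  then show ?thesis using card_mono[of "{x + y}"] by simp
qed

lemma extremes: "Min A \<in> A" "Max A \<in> A" "Min B \<in> B" "Max B \<in> B"
  using finA finB nonempty by (auto intro: Min_in Max_in)

text \<open>The row of \<open>Min A\<close> and the column of \<open>Max B\<close> share at most one
  sum, so there are at least \<open>u + v - 4 * w - 1\<close> sums. Hence
  \<open>r \<ge> - 4 * w - 1\<close>, and the upper bounds on \<open>r\<close> force both sides to
  be large.\<close>

lemma large: "16 * w < u" "16 * w < v"
proof -
  let ?R = "row_sums (Min A) B" and ?C = "col_sums (Max B) A"
  have "card (?R \<inter> ?C) \<le> 1"
  proof (rule card_row_Int_col)
    fix a b assume "a \<in> A" "b \<in> B" "a + Max B = Min A + b"
    then show "b = Max B" using Min_le[OF finA, of a] Max_ge[OF finB, of b] by linarith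
  qed
  moreover have "card ?R + card ?C = card (?R \<union> ?C) + card (?R \<inter> ?C)"
    by (rule card_Un_Int) (auto simp: finite_row_sums finite_col_sums)
  moreover have "card (?R \<union> ?C) \<le> card (restricted_sumset \<Gamma>)"
    using row_sums_subset col_sums_subset finite_sumset by (intro card_mono) auto
  moreover have "real (card B) - w \<le> real (card ?R)" "real (card A) - w \<le> real (card ?C)"
    using extremes by (auto intro!: card_row_sums card_col_sums)
  ultimately have "u + v - 4 * w - 1 \<le> u + v + r" using cardA cardB cardS by linarith
  then show "16 * w < u" "16 * w < v" using r_lt w2 by linarith+
qed

section \<open>Representations of residues and missing edges\<close>

text \<open>Each pair of residues lifts to a pair in \<open>A0 \<times> B0\<close>. If its sum is
  not the residue of a restricted sum, the lifted pair is a non-edge, and distinct pairs lift to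
  distinct non-edges.\<close>

lemma sum_reps_outside:
  assumes "A0 \<subseteq> A" "B0 \<subseteq> B" "inj_on (residue q) A0" "inj_on (residue q) B0"
    and "finite W" "W \<inter> residue q ` restricted_sumset \<Gamma> = {}"
  shows "(\<Sum>g\<in>W. reps (residue q ` A0) (residue q ` B0) g) \<le> card (A \<times> B - \<Gamma>)"
proof -
  let ?A = "residue q ` A0" and ?B = "residue q ` B0"
  have fin: "finite ?A" "finite ?B" using assms(1,2) finA finB by (auto intro: finite_subset)
  have "(\<Sum>g\<in>W. reps ?A ?B g) = card (\<Union>g\<in>W. {p \<in> ?A \<times> ?B. fst p + snd p = g})"
    unfolding reps_def using fin assms(5) by (subst card_UN_disjoint) auto
  also have "\<dots> \<le> card (A \<times> B - \<Gamma>)"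
  proof (rule card_inj_on_le)
    let ?f = "\<lambda>p. (inv_into A0 (residue q) (fst p), inv_into B0 (residue q) (snd p))"
    let ?U = "\<Union>g\<in>W. {p \<in> ?A \<times> ?B. fst p + snd p = g}"
    show "inj_on ?f ?U"
    proof (rule inj_onI)
      fix p p' assume p: "p \<in> ?U" "p' \<in> ?U" "?f p = ?f p'"
      then have "fst p \<in> ?A" "fst p' \<in> ?A" "snd p \<in> ?B" "snd p' \<in> ?B" by auto
      moreover have "inv_into A0 (residue q) (fst p) = inv_into A0 (residue q) (fst p')"
        "inv_into B0 (residue q) (snd p) = inv_into B0 (residue q) (snd p')" using p(3) by auto
      ultimately show "p = p'" by (metis f_inv_into_f prod_eqI)
    qed
    show "?f ` ?U \<subseteq> A \<times> B - \<Gamma>"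
    proof
      fix z assume "z \<in> ?f ` ?U"
      then obtain p where p: "p \<in> ?U" "z = ?f p" by blast
      have pA: "fst p \<in> ?A" and pB: "snd p \<in> ?B" and pW: "fst p + snd p \<in> W" using p(1) by auto
      define x where "x = inv_into A0 (residue q) (fst p)"
      define y where "y = inv_into B0 (residue q) (snd p)"
      have x: "x \<in> A0" "residue q x = fst p" unfolding x_def
        using inv_into_into[OF pA] f_inv_into_f[OF pA] by auto
      have y: "y \<in> B0" "residue q y = snd p" unfolding y_def
        using inv_into_into[OF pB] f_inv_into_f[OF pB] by auto
      have "(x, y) \<notin> \<Gamma>"
      proof
        assume "(x, y) \<in> \<Gamma>"
        then have "residue q (x + y) \<in> residue q ` restricted_sumset \<Gamma>" by (intro imageI in_sumset)
        then show False using pW x y assms(6) by (auto simp: residue_add)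
      qed
      then show "z \<in> A \<times> B - \<Gamma>" using p(2) x(1) y(1) assms(1,2) unfolding x_def y_def by auto
    qed
    show "finite (A \<times> B - \<Gamma>)" using finA finB by simp
  qed
  finally show ?thesis .
qed

text \<open>Residues of restricted sums contribute at most \<open>t\<close> each, all others
  together at most the number of non-edges.\<close>

lemma pollard_sum_le:
  assumes "A0 \<subseteq> A" "B0 \<subseteq> B" "inj_on (residue q) A0" "inj_on (residue q) B0"
  shows "pollard_sum t (residue q ` A0) (residue q ` B0)
    \<le> t * card (residue q ` restricted_sumset \<Gamma>) + card (A \<times> B - \<Gamma>)"
proof -
  let ?A = "residue q ` A0" and ?B = "residue q ` B0" and ?S = "residue q ` restricted_sumset \<Gamma>"
  let ?W = "(\<lambda>p. fst p + snd p) ` (?A \<times> ?B)"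
  have fin: "finite ?A" "finite ?B" using assms(1,2) finA finB by (auto intro: finite_subset)
  then have finW: "finite ?W" by simp
  have "pollard_sum t ?A ?B = (\<Sum>g\<in>?W \<inter> ?S. min t (reps ?A ?B g)) + (\<Sum>g\<in>?W - ?S. min t (reps ?A ?B g))"
    unfolding pollard_sum_def by (rule sum.Int_Diff[OF finW])
  also have "(\<Sum>g\<in>?W \<inter> ?S. min t (reps ?A ?B g)) \<le> (\<Sum>g\<in>?W \<inter> ?S. t)" by (rule sum_mono) simp
  also have "\<dots> \<le> t * card ?S" using finite_sumset by (simp add: card_mono)
  also have "(\<Sum>g\<in>?W - ?S. min t (reps ?A ?B g)) \<le> (\<Sum>g\<in>?W - ?S. reps ?A ?B g)" by (rule sum_mono) simp
  also have "\<dots> \<le> card (A \<times> B - \<Gamma>)" by (rule sum_reps_outside[OF assms]) (use finW in auto)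
  finally show ?thesis by simp
qed

text \<open>Each element of \<open>F\<close> that is not the residue of a restricted sum uses up at
  least \<open>w\<close> of the at most \<open>w * w\<close> non-edges, so there are at most
  \<open>w\<close> of these.\<close>

lemma popular_residues:
  assumes "A0 \<subseteq> A" "B0 \<subseteq> B" "inj_on (residue q) A0" "inj_on (residue q) B0"
    and "finite F" "\<And>g. g \<in> F \<Longrightarrow> t \<le> reps (residue q ` A0) (residue q ` B0) g" "w \<le> real t"
  shows "real (card F) \<le> real (card (residue q ` restricted_sumset \<Gamma>)) + w"
proof -
  let ?S = "residue q ` restricted_sumset \<Gamma>"
  have "card (F - ?S) * t = (\<Sum>g\<in>F - ?S. t)" by simp
  also have "\<dots> \<le> (\<Sum>g\<in>F - ?S. reps (residue q ` A0) (residue q ` B0) g)"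
    by (rule sum_mono) (use assms(6) in auto)
  also have "\<dots> \<le> card (A \<times> B - \<Gamma>)" by (rule sum_reps_outside[OF assms(1-4)]) (use assms(5) in auto)
  finally have "real (card (F - ?S)) * real t \<le> w * w"
    using total by (metis of_nat_le_iff of_nat_mult order_trans)
  moreover have "real (card (F - ?S)) * w \<le> real (card (F - ?S)) * real t"
    using assms(7) by (intro mult_left_mono) auto
  ultimately have "real (card (F - ?S)) * w \<le> w * w" by linarith
  then have "real (card (F - ?S)) \<le> w" using w2 by simp
  moreover have "card F \<le> card (?S \<union> (F - ?S))" using finite_sumset assms(5) by (intro card_mono) auto
  then have "card F \<le> card ?S + card (F - ?S)" using card_Un_le[of ?S "F - ?S"] by linarith
  ultimately show ?thesis by linarith
qed


section \<open>The common difference and cosets of subgroups\<close>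

text \<open>The largest \<open>d\<close> for which \<open>A\<close> and \<open>B\<close> each lie in
  a single class modulo \<open>d\<close>.\<close>

definition step where
  "step = Gcd ((\<lambda>x. x - Min A) ` A \<union> (\<lambda>y. y - Min B) ` B)"

lemma step_dvd: "x \<in> A \<Longrightarrow> step dvd x - Min A" "y \<in> B \<Longrightarrow> step dvd y - Min B"
  unfolding step_def by (auto intro!: Gcd_dvd)

lemma Min_less_Max: "Min A < Max A" "Min B < Max B"
proof -
  have "Min C < Max C" if "finite C" "card C > 1" for C :: "int set"
  proof (rule ccontr)
    assume "\<not> Min C < Max C"
    then have "C \<subseteq> {Min C}" using Min_le[OF that(1)] Max_ge[OF that(1)] by fastforce
    then have "card C \<le> 1" using card_mono[of "{Min C}" C] by simp
    then show False using that by simp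
  qed
  moreover have "card A > 1" "card B > 1" using large cardA cardB w2 by linarith+
  ultimately show "Min A < Max A" "Min B < Max B" using finA finB by auto
qed

lemma step_pos: "step > 0"
proof -
  have "step dvd Max A - Min A" using step_dvd extremes by blast
  then have "step \<noteq> 0" using Min_less_Max by auto
  then show ?thesis unfolding step_def by (metis Gcd_int_greater_eq_0 order_le_less)
qed

lemma step_in_subgroup:
  assumes "\<And>x. x \<in> A \<Longrightarrow> x - Min A \<in> L" "\<And>y. y \<in> B \<Longrightarrow> y - Min B \<in> L"
    and "0 \<in> L" "\<And>x y. x \<in> L \<Longrightarrow> y \<in> L \<Longrightarrow> x - y \<in> L"
  shows "step \<in> L"
  unfolding step_def by (rule Gcd_in_subgroup) (use assms finA finB in auto)

text \<open>Every further coset of \<open>L\<close> met by \<open>A\<close> or \<open>B\<close> would add about \<open>card B\<close> or \<open>card A\<close> new sums.\<close>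

lemma coset_contains_all:
  fixes L :: "int set"
  assumes L0: "0 \<in> L" and Ld: "\<And>x y. x \<in> L \<Longrightarrow> y \<in> L \<Longrightarrow> x - y \<in> L"
    and B1: "B1 \<subseteq> B" "\<And>y. y \<in> B1 \<Longrightarrow> y - \<beta> \<in> L" "v - 3 * w - 2 \<le> real (card B1)"
  shows "(\<forall>x\<in>A. x - Min A \<in> L) \<and> (\<forall>y\<in>B. y - Min B \<in> L)"
proof -
  have neg: "- x \<in> L" if "x \<in> L" for x using Ld[OF L0 that] by simp
  have add: "x + y \<in> L" if "x \<in> L" "y \<in> L" for x y using Ld[OF that(1) neg[OF that(2)]] by simp
  have finB1: "finite B1" using B1(1) finB by (rule finite_subset)
  have "B1 \<noteq> {}" using B1(3) large w2 by auto
  then have m: "Max B1 \<in> B1" using finB1 by simp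
  then have mB: "Max B1 \<in> B" using B1(1) by blast
  have B1d: "y - y' \<in> L" if "y \<in> B1" "y' \<in> B1" for y y'
    using Ld[OF B1(2)[OF that(1)] B1(2)[OF that(2)]] by simp
  let ?S = "restricted_sumset \<Gamma>"
  let ?R = "row_sums (Min A) B1" and ?C = "col_sums (Max B1) A"
  have cR: "real (card B1) - w \<le> real (card ?R)" using extremes B1(1) by (intro card_row_sums)
  have cC: "real (card A) - w \<le> real (card ?C)" using mB by (intro card_col_sums) auto
  have RC: "card (?R \<inter> ?C) \<le> 1"
  proof (rule card_row_Int_col)
    fix a b assume "a \<in> A" "b \<in> B1" "a + Max B1 = Min A + b"
    then show "b = Max B1" using Min_le[OF finA, of a] Max_ge[OF finB1, of b] by linarith
  qed
  have U1: "card ?R + card ?C = card (?R \<union> ?C) + card (?R \<inter> ?C)"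
    by (rule card_Un_Int) (auto simp: finite_row_sums finite_col_sums)
  have 1: "x - Min A \<in> L" if x: "x \<in> A" for x
  proof (rule ccontr)
    assume n: "x - Min A \<notin> L"
    \<comment> \<open>The coset of \<open>x\<close> within \<open>A\<close>. Its minimum is used so
      that the new row meets the column of \<open>Max B1\<close> only in the corner: a coincidence
      forces \<open>a\<close> into \<open>?X\<close>, hence \<open>Min ?X \<le> a\<close>.\<close>
    let ?X = "{x' \<in> A. x' - x \<in> L}"
    have finX: "finite ?X" using finA by simp
    have "x \<in> ?X" using x L0 by simp
    then have "Min ?X \<in> ?X" using finX by (intro Min_in) auto
    then have mX: "Min ?X \<in> A" "Min ?X - x \<in> L" by auto
    let ?R2 = "row_sums (Min ?X) B1"
    have cR2: "real (card B1) - w \<le> real (card ?R2)" using mX B1(1) by (intro card_row_sums)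
    have d: "?R \<inter> ?R2 = {}"
    proof (rule ccontr)
      assume "?R \<inter> ?R2 \<noteq> {}"
      then obtain y y' where y: "y \<in> B1" "y' \<in> B1" "Min A + y = Min ?X + y'"
        unfolding row_sums_def by auto
      have "(y - y') - (Min ?X - x) \<in> L" using B1d y mX Ld by blast
      moreover have "(y - y') - (Min ?X - x) = x - Min A" using y(3) by linarith
      ultimately show False using n by simp
    qed
    have R2C: "card (?R2 \<inter> ?C) \<le> 1"
    proof (rule card_row_Int_col)
      fix a b assume a: "a \<in> A" "b \<in> B1" "a + Max B1 = Min ?X + b"
      have "(Min ?X - x) + (b - Max B1) \<in> L" using B1d[OF a(2) m] mX add by blast
      moreover have "(Min ?X - x) + (b - Max B1) = a - x" using a(3) by linarith
      ultimately have "a \<in> ?X" using a by simp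
      then have "Min ?X \<le> a" using finX by (rule Min_le[rotated])
      then show "b = Max B1" using a(3) Max_ge[OF finB1 a(2)] by linarith
    qed
    have "card ?R2 + card (?R \<union> ?C) = card (?R2 \<union> (?R \<union> ?C)) + card (?R2 \<inter> (?R \<union> ?C))"
      by (rule card_Un_Int) (auto simp: finite_row_sums finite_col_sums)
    moreover have "?R2 \<inter> (?R \<union> ?C) = ?R2 \<inter> ?C" using d by auto
    then have "card (?R2 \<inter> (?R \<union> ?C)) \<le> 1" using R2C by simp
    moreover have "card (?R2 \<union> (?R \<union> ?C)) \<le> card ?S"
      using row_sums_subset col_sums_subset finite_sumset by (intro card_mono) auto
    ultimately have "real (card ?R2) + real (card ?R) + real (card ?C) - 2 \<le> real (card ?S)"
      using U1 RC R2C by linarith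
    \<comment> \<open>Two rows over \<open>B1\<close> and one column give at least
      \<open>u + 2 * v - 10 * w - 6\<close> sums, so \<open>r \<ge> v - 10 * w - 6\<close>, against
      \<open>r < v / 2 - 13 * w\<close>.\<close>
    then show False using cR cC cR2 cardS cardA B1(3) r_lt large w2 by linarith
  qed
  have 2: "y - Min B \<in> L" if y: "y \<in> B" for y
  proof (rule ccontr)
    assume n: "y - Min B \<notin> L"
    \<comment> \<open>\<open>y\<close> and \<open>Min B\<close> are in different cosets, so one of
      them is outside \<open>\<beta> + L\<close>. By the first part \<open>A\<close> lies in one
      coset, so the column of such an element avoids the row over \<open>B1\<close> and the column
      of \<open>Max B1\<close>.\<close>
    have "\<exists>y2\<in>B. y2 - \<beta> \<notin> L"
    proof (rule ccontr)
      assume "\<not> ?thesis"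
      then have "(y - \<beta>) - (Min B - \<beta>) \<in> L" using y extremes Ld by blast
      then show False using n by simp
    qed
    then obtain y2 where y2: "y2 \<in> B" "y2 - \<beta> \<notin> L" by blast
    have y2B1: "y2 - y' \<notin> L" if "y' \<in> B1" for y'
    proof
      assume "y2 - y' \<in> L"
      then have "(y2 - y') + (y' - \<beta>) \<in> L" using B1(2)[OF that] by (rule add)
      then show False using y2 by simp
    qed
    have Ad: "x - x' \<in> L" if "x \<in> A" "x' \<in> A" for x x'
      using Ld[OF 1[OF that(1)] 1[OF that(2)]] by simp
    let ?C2 = "col_sums y2 A"
    have cC2: "real (card A) - w \<le> real (card ?C2)" using y2 by (intro card_col_sums) auto
    have d1: "?C2 \<inter> ?C = {}"
    proof (rule ccontr)
      assume "?C2 \<inter> ?C \<noteq> {}"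
      then obtain a a' where a: "a \<in> A" "a' \<in> A" "a + y2 = a' + Max B1"
        unfolding col_sums_def by auto
      then have "y2 - Max B1 = a' - a" by linarith
      then show False using y2B1[OF m] Ad[OF a(2,1)] by simp
    qed
    have d2: "?C2 \<inter> ?R = {}"
    proof (rule ccontr)
      assume "?C2 \<inter> ?R \<noteq> {}"
      then obtain a b where a: "a \<in> A" "b \<in> B1" "a + y2 = Min A + b"
        unfolding col_sums_def row_sums_def by auto
      then have "y2 - b = Min A - a" by linarith
      then show False using y2B1[OF a(2)] Ad[OF extremes(1) a(1)] by simp
    qed
    have "card ?C2 + card (?R \<union> ?C) = card (?C2 \<union> (?R \<union> ?C)) + card (?C2 \<inter> (?R \<union> ?C))"
      by (rule card_Un_Int) (auto simp: finite_row_sums finite_col_sums)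
    moreover have "?C2 \<inter> (?R \<union> ?C) = {}" using d1 d2 by auto
    moreover have "card (?C2 \<union> (?R \<union> ?C)) \<le> card ?S"
      using row_sums_subset col_sums_subset finite_sumset by (intro card_mono) auto
    ultimately have "real (card ?C2) + real (card ?R) + real (card ?C) - 1 \<le> real (card ?S)"
      using U1 RC by (simp; linarith)
    then show False using cR cC cC2 cardS cardA B1(3) r_lt large w2 by linarith
  qed
  show ?thesis using 1 2 by blast
qed


section \<open>Diameter of the longer side\<close>

lemma obtain_threshold: obtains t :: nat where "1 \<le> t" "w \<le> real t" "real t < w + 1"
proof
  show "1 \<le> nat \<lceil>w\<rceil>" "w \<le> real (nat \<lceil>w\<rceil>)" "real (nat \<lceil>w\<rceil>) < w + 1" using w2 by linarith+
qed

text \<open>The multiples of \<open>step\<close> form a subgroup of order \<open>q div step\<close>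
  modulo \<open>q\<close>, and the image is one of its cosets.\<close>

lemma card_step_progression:
  assumes "q > 0" "step dvd q"
  shows "card ((\<lambda>k. c + residue q (step * int k)) ` {..<nat (q div step)}) = nat (q div step)"
proof -
  have "inj_on (\<lambda>k. c + residue q (step * int k)) {..<nat (q div step)}"
  proof (rule inj_onI)
    fix k l assume kl: "k \<in> {..<nat (q div step)}" "l \<in> {..<nat (q div step)}"
      "c + residue q (step * int k) = c + residue q (step * int l)"
    have q: "q = step * (q div step)" using assms(2) by simp
    have "\<bar>int k - int l\<bar> < q div step" using kl(1,2) by auto
    then have "step * \<bar>int k - int l\<bar> < step * (q div step)" using step_pos by simp
    then have "\<bar>step * int k - step * int l\<bar> < q"
      using q step_pos by (simp add: right_diff_distrib[symmetric] abs_mult)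
    then have "step * int k = step * int l" using kl(3) assms(1) by (intro residue_eqD) auto
    then show "k = l" using step_pos by simp
  qed
  then show ?thesis by (simp add: card_image)
qed

text \<open>Modulo \<open>Max A - Min A\<close> the residues of \<open>Min A + y\<close> are hit twice, by \<open>Min A + y\<close> and \<open>Max A + y\<close>.\<close>

lemma card_sumset_ge_long:
  assumes "Max B - Min B \<le> Max A - Min A"
  shows "real (card (residue (Max A - Min A) ` restricted_sumset \<Gamma>)) + real (card (B - {Max B})) - 2 * w
    \<le> real (card (restricted_sumset \<Gamma>))"
proof -
  define q where "q = Max A - Min A"
  \<comment> \<open>\<open>Max B\<close> is left out because, if the diameters agree,
    \<open>Min A + Max B\<close> equals \<open>Max A + Min B\<close> and could itself be deleted
    with \<open>?T\<close>.\<close>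
  let ?S = "restricted_sumset \<Gamma>" and ?B0 = "B - {Max B}"
  let ?D = "{y \<in> ?B0. (Min A, y) \<in> \<Gamma> \<and> (Max A, y) \<in> \<Gamma>}"
  let ?T = "(\<lambda>y. Max A + y) ` ?D"
  have finD: "finite ?D" using finB by simp
  have TS: "?T \<subseteq> ?S" using in_sumset by auto
  have "residue q ` ?S \<subseteq> residue q ` (?S - ?T)"
  proof
    fix g assume "g \<in> residue q ` ?S"
    then obtain s where s: "s \<in> ?S" "g = residue q s" by blast
    show "g \<in> residue q ` (?S - ?T)"
    proof (cases "s \<in> ?T")
      case True
      then obtain y where y: "y \<in> ?D" "s = Max A + y" by blast
      have "Min A + y \<in> ?S" using y in_sumset by auto
      moreover have "Min A + y \<notin> ?T"
      proof
        assume "Min A + y \<in> ?T"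
        then obtain y' where y': "y' \<in> ?D" "Min A + y = Max A + y'" by blast
        have "y \<le> Max B" "y \<noteq> Max B" "Min B \<le> y'" using y y' finB by auto
        then show False using y'(2) assms by linarith
      qed
      moreover have "residue q (Min A + y) = residue q s"
      proof -
        have "q > 0" unfolding q_def using Min_less_Max by simp
        moreover have "Min A + y - s = - q" using y(2) unfolding q_def by simp
        ultimately show ?thesis by (simp add: residue_eq_iff)
      qed
      ultimately show ?thesis using s(2) by (intro image_eqI[of _ _ "Min A + y"] DiffI) simp_all
    next
      case False
      then show ?thesis using s by blast
    qed
  qed
  then have "card (residue q ` ?S) \<le> card (residue q ` (?S - ?T))"
    using finite_sumset by (intro card_mono) auto
  also have "\<dots> \<le> card (?S - ?T)" using finite_sumset by (intro card_image_le) auto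
  also have "\<dots> = card ?S - card ?T" using TS finite_sumset finD by (intro card_Diff_subset) auto
  finally have "card (residue q ` ?S) \<le> card ?S - card ?T" .
  moreover have "card ?T \<le> card ?S" using TS finite_sumset by (intro card_mono)
  moreover have "card ?T = card ?D" by (simp add: card_image)
  moreover have "card ?B0 \<le> card ?D + card {y \<in> B. (Min A, y) \<notin> \<Gamma>} + card {y \<in> B. (Max A, y) \<notin> \<Gamma>}"
  proof -
    have "card ?B0 \<le> card ((?D \<union> {y \<in> B. (Min A, y) \<notin> \<Gamma>}) \<union> {y \<in> B. (Max A, y) \<notin> \<Gamma>})"
      using finB by (intro card_mono) auto
    also have "\<dots> \<le> card (?D \<union> {y \<in> B. (Min A, y) \<notin> \<Gamma>}) + card {y \<in> B. (Max A, y) \<notin> \<Gamma>}"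
      by (rule card_Un_le)
    also have "card (?D \<union> {y \<in> B. (Min A, y) \<notin> \<Gamma>}) \<le> card ?D + card {y \<in> B. (Min A, y) \<notin> \<Gamma>}"
      by (rule card_Un_le)
    finally show ?thesis by simp
  qed
  ultimately show ?thesis using row[OF extremes(1)] row[OF extremes(2)]
    unfolding q_def[symmetric] by linarith
qed

text \<open>Of the alternatives in \<open>olson_pollard\<close>, the first contradicts the bound on
  \<open>r\<close>. In the second, \<open>H\<close> contains the residues of all multiples of
  \<open>step\<close>, so the periodic set \<open>F\<close> has at least \<open>q div step\<close>
  elements, nearly all of them residues of restricted sums.\<close>

lemma long_side_length:
  assumes le: "Max B - Min B \<le> Max A - Min A"
  shows "real_of_int ((Max A - Min A) div step) + 1 \<le> u + r + 5 * w"
proof -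
  define q where "q = Max A - Min A"
  have q: "q > 0" unfolding q_def using Min_less_Max by simp
  let ?S = "residue q ` restricted_sumset \<Gamma>"
  \<comment> \<open>\<open>Max A\<close> has the residue of \<open>Min A\<close>, and
    \<open>Max B\<close> that of \<open>Min B\<close> if the diameters agree; without them reduction
    is injective.\<close>
  define A0 where "A0 = A - {Max A}"
  define B0 where "B0 = B - {Max B}"
  have c0: "card A = card A0 + 1" "card B = card B0 + 1"
    unfolding A0_def B0_def using finA finB extremes card_Suc_Diff1 by fastforce+
  have fin0: "finite A0" "finite B0" unfolding A0_def B0_def using finA finB by auto
  have injA: "inj_on (residue q) A0"
  proof (rule inj_onI)
    fix x y assume xy: "x \<in> A0" "y \<in> A0" "residue q x = residue q y"
    then have "x \<le> Max A" "x \<noteq> Max A" "y \<le> Max A" "y \<noteq> Max A" "Min A \<le> x" "Min A \<le> y"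
      using finA unfolding A0_def by auto
    then have "\<bar>x - y\<bar> < q" unfolding q_def by linarith
    then show "x = y" using q xy(3) by (intro residue_eqD)
  qed
  have injB: "inj_on (residue q) B0"
  proof (rule inj_onI)
    fix x y assume xy: "x \<in> B0" "y \<in> B0" "residue q x = residue q y"
    then have "x \<le> Max B" "x \<noteq> Max B" "y \<le> Max B" "y \<noteq> Max B" "Min B \<le> x" "Min B \<le> y"
      using finB unfolding B0_def by auto
    then have "\<bar>x - y\<bar> < q" using le unfolding q_def by linarith
    then show "x = y" using q xy(3) by (intro residue_eqD)
  qed
  have sub0: "A0 \<subseteq> A" "B0 \<subseteq> B" unfolding A0_def B0_def by auto
  have cim: "card (residue q ` A0) = card A0" "card (residue q ` B0) = card B0"
    using injA injB by (auto simp: card_image)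
  obtain t :: nat where t: "1 \<le> t" "w \<le> real t" "real t < w + 1" by (rule obtain_threshold)
  have S: "real (card ?S) \<le> u + r + 3 * w + 1"
    using card_sumset_ge_long[OF le] cardS cardB c0 unfolding q_def B0_def by linarith
  have tA: "t \<le> card A0" "t \<le> card B0" using t c0 cardA cardB large w2 by linarith+
  have "t * (2 * card A0 + card B0) \<le> 2 * pollard_sum t (residue q ` A0) (residue q ` B0) + 3 * t * t \<or>
    (\<exists>H F b0. b0 \<in> residue q ` B0 \<and> 0 \<in> H \<and> (\<forall>x\<in>H. \<forall>y\<in>H. x - y \<in> H) \<and>
       finite F \<and> F \<noteq> {} \<and> (\<forall>f\<in>F. \<forall>h\<in>H. f + h \<in> F) \<and>
       card {b \<in> residue q ` B0. b - b0 \<notin> H} < t \<and>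
       (\<forall>g\<in>F. t \<le> reps (residue q ` A0) (residue q ` B0) g))"
    using olson_pollard[of "residue q ` A0" "residue q ` B0" t] fin0 t(1) tA unfolding cim by blast
  then show ?thesis
  proof
    assume "t * (2 * card A0 + card B0) \<le> 2 * pollard_sum t (residue q ` A0) (residue q ` B0) + 3 * t * t"
    also have "\<dots> \<le> 2 * (t * card ?S + card (A \<times> B - \<Gamma>)) + 3 * t * t"
      by (intro add_mono mult_le_mono order_refl pollard_sum_le[OF sub0 injA injB])
    finally have "real (t * (2 * card A0 + card B0)) \<le> real (2 * (t * card ?S + card (A \<times> B - \<Gamma>)) + 3 * t * t)"
      by (rule of_nat_mono)
    then have "real t * (2 * real (card A0) + real (card B0))
        \<le> 2 * (real t * real (card ?S)) + 2 * real (card (A \<times> B - \<Gamma>)) + 3 * (real t * real t)" by simp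
    moreover have "w * w \<le> real t * w" using t(2) w2 by (intro mult_right_mono) auto
    ultimately have "real t * (2 * real (card A0) + real (card B0)) \<le> real t * (2 * real (card ?S) + 2 * w + 3 * real t)"
      using total by (simp add: algebra_simps)
    then have "2 * real (card A0) + real (card B0) \<le> 2 * real (card ?S) + 2 * w + 3 * real t"
      using t(1) by simp
    \<comment> \<open>With \<open>t < w + 1\<close> this would give
      \<open>v < 2 * r + 14 * w + 8\<close>, while \<open>2 * r + 26 * w < v\<close> and
      \<open>2 \<le> w\<close>.\<close>
    then have False using S t c0 cardA cardB r_lt w2 by linarith
    then show ?thesis ..
  next
    assume "\<exists>H F b0. b0 \<in> residue q ` B0 \<and> 0 \<in> H \<and> (\<forall>x\<in>H. \<forall>y\<in>H. x - y \<in> H) \<and>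
       finite F \<and> F \<noteq> {} \<and> (\<forall>f\<in>F. \<forall>h\<in>H. f + h \<in> F) \<and>
       card {b \<in> residue q ` B0. b - b0 \<notin> H} < t \<and>
       (\<forall>g\<in>F. t \<le> reps (residue q ` A0) (residue q ` B0) g)"
    then obtain H F b0 where b0: "b0 \<in> residue q ` B0" and H0: "0 \<in> H"
      and Hd: "\<forall>x\<in>H. \<forall>y\<in>H. x - y \<in> H" and F: "finite F" "F \<noteq> {}" "\<forall>f\<in>F. \<forall>h\<in>H. f + h \<in> F"
      and Bt: "card {b \<in> residue q ` B0. b - b0 \<notin> H} < t"
      and pop: "\<forall>g\<in>F. t \<le> reps (residue q ` A0) (residue q ` B0) g"
      by (elim exE conjE) (rule that; assumption)
    obtain \<beta> where \<beta>: "\<beta> \<in> B0" "b0 = residue q \<beta>" using b0 by blast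
    \<comment> \<open>The preimage of \<open>H\<close>. All but fewer than \<open>t\<close> points
      of \<open>B0\<close> lie in \<open>\<beta> + L\<close>, enough to force \<open>A\<close> and
      \<open>B\<close> into single cosets of \<open>L\<close>.\<close>
    define L where "L = {x. residue q x \<in> H}"
    have res0: "residue q 0 = 0" using residue_diff[of q 0 0] by simp
    have L0: "0 \<in> L" unfolding L_def using H0 res0 by simp
    have Ld: "x - y \<in> L" if "x \<in> L" "y \<in> L" for x y
      using that Hd unfolding L_def by (simp add: residue_diff)
    define B1 where "B1 = {y \<in> B0. y - \<beta> \<in> L}"
    have "card B0 = card (B1 \<union> {y \<in> B0. y - \<beta> \<notin> L})"
      unfolding B1_def by (rule arg_cong[of _ _ card]) auto
    also have "\<dots> \<le> card B1 + card {y \<in> B0. y - \<beta> \<notin> L}" by (rule card_Un_le)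
    also have "card {y \<in> B0. y - \<beta> \<notin> L} \<le> card {b \<in> residue q ` B0. b - b0 \<notin> H}"
    proof (rule card_inj_on_le[of "residue q"])
      show "inj_on (residue q) {y \<in> B0. y - \<beta> \<notin> L}" using injB by (rule inj_on_subset) auto
      show "residue q ` {y \<in> B0. y - \<beta> \<notin> L} \<subseteq> {b \<in> residue q ` B0. b - b0 \<notin> H}"
        unfolding L_def \<beta>(2) by (auto simp: residue_diff)
    qed (use fin0 in simp)
    finally have cB1: "card B0 < card B1 + t" using Bt by linarith
    have all: "(\<forall>x\<in>A. x - Min A \<in> L) \<and> (\<forall>y\<in>B. y - Min B \<in> L)"
    proof (rule coset_contains_all[OF L0 Ld])
      show "B1 \<subseteq> B" "\<And>y. y \<in> B1 \<Longrightarrow> y - \<beta> \<in> L" unfolding B1_def using sub0 by auto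
      show "v - 3 * w - 2 \<le> real (card B1)" using cB1 t c0 cardB w2 by linarith
    qed
    have stepL: "step \<in> L" by (rule step_in_subgroup) (use all L0 Ld in auto)
    have multL: "step * int k \<in> L" for k
    proof (induction k)
      case (Suc k)
      have "step * int k - (0 - step) \<in> L" by (intro Ld Suc L0 stepL)
      then show ?case by (simp add: algebra_simps)
    qed (use L0 in simp)
    obtain f where f: "f \<in> F" using F(2) by blast
    have dq: "step dvd q" unfolding q_def using step_dvd extremes by blast
    have "(\<lambda>k. f + residue q (step * int k)) ` {..<nat (q div step)} \<subseteq> F"
      using F(3) f multL unfolding L_def by auto
    then have "nat (q div step) \<le> card F"
      using card_mono[OF F(1)] card_step_progression[OF q dq, of f] by metis
    then have "real_of_int (q div step) \<le> real (card F)" by linarith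
    moreover have "real (card F) \<le> real (card ?S) + w"
      by (rule popular_residues[OF sub0 injA injB F(1) _ t(2)]) (use pop in auto)
    \<comment> \<open>This gives \<open>q div step \<le> u + r + 4 * w + 1\<close>; the constants
      are absorbed by \<open>2 \<le> w\<close>.\<close>
    ultimately show ?thesis using S w2 unfolding q_def by linarith
  qed
qed


section \<open>Diameter of the shorter side\<close>

text \<open>Modulo \<open>Max B - Min B\<close>, the translates \<open>A + Min B\<close> and \<open>A + Max B\<close> have the same residues, and in
  each residue class the largest element of the second one is not in the first.\<close>

lemma card_sumset_ge_short:
  defines "q \<equiv> Max B - Min B"
  shows "real (card A) - 2 * w + real (card (residue q ` restricted_sumset \<Gamma>))
    \<le> real (card (restricted_sumset \<Gamma>))"
proof -
  have q: "q > 0" unfolding q_def using Min_less_Max by simp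
  let ?S = "restricted_sumset \<Gamma>" and ?R = "residue q ` A"
  define m where "m \<rho> = Max {x \<in> A. residue q x = \<rho>}" for \<rho>
  have m: "m \<rho> \<in> A" "residue q (m \<rho>) = \<rho>" if "\<rho> \<in> ?R" for \<rho>
  proof -
    have "Max {x \<in> A. residue q x = \<rho>} \<in> {x \<in> A. residue q x = \<rho>}"
      using finA that by (intro Max_in) auto
    then show "m \<rho> \<in> A" "residue q (m \<rho>) = \<rho>" unfolding m_def by auto
  qed
  have mmax: "x \<le> m (residue q x)" if "x \<in> A" for x
    unfolding m_def using finA that by (intro Max_ge) auto
  \<comment> \<open>Three disjoint sets of sums: the column of \<open>Min B\<close>, the class
    maxima in the column of \<open>Max B\<close>, and the sums with residue outside that of
    \<open>A + Min B\<close>. The last two together have at least as many elements as there are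
    residues of sums, up to \<open>w\<close>.\<close>
  let ?T1 = "col_sums (Min B) A"
  let ?R' = "{\<rho> \<in> ?R. (m \<rho>, Max B) \<in> \<Gamma>}"
  let ?T2 = "(\<lambda>\<rho>. m \<rho> + Max B) ` ?R'"
  let ?C = "(\<lambda>\<rho>. \<rho> + residue q (Min B)) ` ?R"
  let ?T3 = "{s \<in> ?S. residue q s \<notin> ?C}"
  have qB: "residue q (Max B) = residue q (Min B)" using q unfolding q_def by (simp add: residue_eq_iff)
  have fin: "finite ?T1" "finite ?T2" "finite ?T3" "finite ?R"
    using finA finite_sumset finite_col_sums by auto
  have d12: "?T1 \<inter> ?T2 = {}"
  proof (rule ccontr)
    assume "?T1 \<inter> ?T2 \<noteq> {}"
    then obtain x \<rho> where x: "x \<in> A" "\<rho> \<in> ?R" "x + Min B = m \<rho> + Max B"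
      unfolding col_sums_def by auto
    then have xm: "x = m \<rho> + q" unfolding q_def by linarith
    then have "residue q x = \<rho>" using q m(2)[OF x(2)] residue_eq_iff[OF q, of x "m \<rho>"] by simp
    then show False using mmax[OF x(1)] xm q by simp
  qed
  have "?T1 \<inter> ?T3 = {}"
    unfolding col_sums_def by (auto simp: residue_add)
  moreover have "?T2 \<inter> ?T3 = {}"
  proof -
    have "residue q (m \<rho> + Max B) \<in> ?C" if "\<rho> \<in> ?R" for \<rho>
      using m(2)[OF that] that qB by (auto simp: residue_add)
    then show ?thesis by blast
  qed
  ultimately have "card (?T1 \<union> ?T2 \<union> ?T3) = card ?T1 + card ?T2 + card ?T3"
    using d12 fin by (subst card_Un_disjoint; auto simp: card_Un_disjoint)
  moreover have "card (?T1 \<union> ?T2 \<union> ?T3) \<le> card ?S"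
  proof (rule card_mono[OF finite_sumset])
    show "?T1 \<union> ?T2 \<union> ?T3 \<subseteq> ?S" using col_sums_subset[of "Min B" A] in_sumset by auto
  qed
  moreover have "real (card A) - w \<le> real (card ?T1)" using extremes by (intro card_col_sums) auto
  moreover have "real (card ?R) - w \<le> real (card ?T2)"
  proof -
    have "card ?R = card (?R' \<union> {\<rho> \<in> ?R. (m \<rho>, Max B) \<notin> \<Gamma>})"
      by (rule arg_cong[of _ _ card]) auto
    also have "\<dots> \<le> card ?R' + card {\<rho> \<in> ?R. (m \<rho>, Max B) \<notin> \<Gamma>}" by (rule card_Un_le)
    also have "card {\<rho> \<in> ?R. (m \<rho>, Max B) \<notin> \<Gamma>} \<le> card {x \<in> A. (x, Max B) \<notin> \<Gamma>}"
    proof (rule card_inj_on_le[of m])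
      show "inj_on m {\<rho> \<in> ?R. (m \<rho>, Max B) \<notin> \<Gamma>}"
        by (rule inj_on_inverseI[of _ "residue q"]) (use m(2) in blast)
      show "m ` {\<rho> \<in> ?R. (m \<rho>, Max B) \<notin> \<Gamma>} \<subseteq> {x \<in> A. (x, Max B) \<notin> \<Gamma>}" using m(1) by blast
    qed (use finA in simp)
    finally have "card ?R \<le> card ?R' + card {x \<in> A. (x, Max B) \<notin> \<Gamma>}" by simp
    moreover have "card ?T2 = card ?R'"
    proof (rule card_image, rule inj_onI)
      fix \<rho> \<sigma> assume a: "\<rho> \<in> ?R'" "\<sigma> \<in> ?R'" "m \<rho> + Max B = m \<sigma> + Max B"
      then have "\<rho> \<in> ?R" "\<sigma> \<in> ?R" "m \<rho> = m \<sigma>" by auto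
      then show "\<rho> = \<sigma>" using m(2) by metis
    qed
    ultimately show ?thesis using col[OF extremes(4)] by linarith
  qed
  moreover have "card (residue q ` ?S) \<le> card ?T3 + card ?R"
  proof -
    have "residue q ` ?S \<subseteq> residue q ` ?T3 \<union> ?C" by blast
    then have "card (residue q ` ?S) \<le> card (residue q ` ?T3 \<union> ?C)" using fin by (intro card_mono) auto
    also have "\<dots> \<le> card (residue q ` ?T3) + card ?C" by (rule card_Un_le)
    also have "card (residue q ` ?T3) \<le> card ?T3" using fin by (intro card_image_le)
    also have "card ?C \<le> card ?R" using fin by (intro card_image_le)
    finally show ?thesis by simp
  qed
  ultimately show ?thesis by linarith
qed

text \<open>Pigeonhole: for \<open>g\<close> in the coset \<open>F\<close>, the residues of
  \<open>A\<close> and of \<open>g - B0\<close> lie in one coset with \<open>c = q div step\<close>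
  elements, which \<open>A\<close> nearly fills. They overlap in at least \<open>t\<close> places,
  so nearly all of \<open>F\<close> is hit, and \<open>card_sumset_ge_short\<close> bounds
  \<open>c\<close>.\<close>

lemma short_side_length:
  assumes le: "Max B - Min B \<le> Max A - Min A"
  shows "real_of_int ((Max B - Min B) div step) + 1 \<le> v + r + 5 * w"
proof -
  define q where "q = Max B - Min B"
  have q: "q > 0" unfolding q_def using Min_less_Max by simp
  have dq: "step dvd q" unfolding q_def using step_dvd extremes by blast
  define c where "c = nat (q div step)"
  define a where "a = nat ((Max A - Min A) div step)"
  have ca: "c \<le> a" unfolding a_def c_def q_def using le step_pos by (intro nat_mono zdiv_mono1)
  have a: "real a + 1 \<le> u + r + 5 * w"
    using long_side_length[OF le] Min_less_Max step_pos unfolding a_def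
    by (simp add: pos_imp_zdiv_nonneg_iff)
  obtain t :: nat where t: "1 \<le> t" "w \<le> real t" "real t < w + 1" by (rule obtain_threshold)
  let ?S = "residue q ` restricted_sumset \<Gamma>" and ?R = "residue q ` A"
  \<comment> \<open>\<open>A\<close> may have several points in one residue class modulo the shorter
    diameter; one is kept from each.\<close>
  obtain A0 where A0: "A0 \<subseteq> A" "inj_on (residue q) A0" "?R = residue q ` A0"
    using subset_image_inj[of ?R "residue q" A] by auto
  define B0 where "B0 = B - {Max B}"
  have sub0: "B0 \<subseteq> B" unfolding B0_def by auto
  have cB0: "card B = card B0 + 1" unfolding B0_def using finB extremes card_Suc_Diff1 by fastforce
  have injB: "inj_on (residue q) B0"
  proof (rule inj_onI)
    fix x y assume xy: "x \<in> B0" "y \<in> B0" "residue q x = residue q y"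
    then have "x \<le> Max B" "x \<noteq> Max B" "y \<le> Max B" "y \<noteq> Max B" "Min B \<le> x" "Min B \<le> y"
      using finB unfolding B0_def by auto
    then have "\<bar>x - y\<bar> < q" unfolding q_def by linarith
    then show "x = y" using q xy(3) by (intro residue_eqD)
  qed
  define K where "K = (\<lambda>k. residue q (step * int k)) ` {..<c}"
  have cK: "card ((\<lambda>k. z + residue q (step * int k)) ` {..<c}) = c" for z
    unfolding c_def by (rule card_step_progression[OF q dq])
  have K: "residue q (step * k) \<in> K" for k
  proof -
    have qc: "q = step * int c" unfolding c_def using q dq step_pos
      by (simp add: pos_imp_zdiv_nonneg_iff)
    have cpos: "int c > 0" using qc q step_pos by (simp add: zero_less_mult_iff)
    have "residue q (step * k) = residue q (step * (k mod int c))"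
    proof -
      have "step * k - step * (k mod int c) = q * (k div int c)"
        unfolding qc by (simp add: minus_mod_eq_mult_div right_diff_distrib[symmetric])
      then show ?thesis by (simp add: residue_eq_iff[OF q])
    qed
    moreover have "k mod int c = int (nat (k mod int c))" "nat (k mod int c) < c"
      using cpos by (auto simp: nat_less_iff)
    ultimately show ?thesis unfolding K_def by (metis imageI lessThan_iff)
  qed
  define F where "F = (\<lambda>k. residue q (Min A + Min B) + residue q (step * int k)) ` {..<c}"
  have cF: "card F = c" unfolding F_def by (rule cK)
  define G where "G = (\<lambda>k. residue q (Min A) + residue q (step * int k)) ` {..<c}"
  have GK: "residue q (Min A) + z \<in> G" if "z \<in> K" for z using that unfolding G_def K_def by blast
  have RG: "?R \<subseteq> G"
  proof
    fix g assume "g \<in> ?R"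
    then obtain x where x: "x \<in> A" "g = residue q x" by blast
    obtain k where "x - Min A = step * k" using step_dvd(1)[OF x(1)] by (auto elim: dvdE)
    then have "residue q x = residue q (Min A) + residue q (step * k)"
      by (simp flip: residue_add) (metis add.commute diff_add_cancel)
    then show "g \<in> G" using GK[OF K] x(2) by simp
  qed
  \<comment> \<open>The progression \<open>?I\<close> of \<open>a + 1\<close> terms covers all
    \<open>c\<close> residues in \<open>G\<close> because \<open>c \<le> a\<close>, and
    \<open>A\<close> misses only \<open>a + 1 - card A\<close> of its terms, hence at most that many
    residues.\<close>
  have cR: "c + card A \<le> card ?R + a + 1"
  proof -
    let ?I = "(\<lambda>k. Min A + int k * step) ` {..a}"
    have AI: "A \<subseteq> ?I" unfolding a_def by (rule subset_progression[OF finA step_pos step_dvd(1)])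
    have "card ?I \<le> a + 1" using card_image_le[of "{..a}"] by simp
    moreover have "card (?I - A) = card ?I - card A" using AI finA by (intro card_Diff_subset)
    ultimately have cI: "card (?I - A) + card A \<le> a + 1" using card_mono[OF _ AI] by simp
    have "G \<subseteq> ?R \<union> residue q ` (?I - A)"
    proof
      fix g assume "g \<in> G"
      then obtain k where k: "k < c" "g = residue q (Min A + int k * step)"
        unfolding G_def by (auto simp: residue_add mult.commute)
      then have "Min A + int k * step \<in> ?I" using ca by auto
      then show "g \<in> ?R \<union> residue q ` (?I - A)" using k(2) by blast
    qed
    then have "card G \<le> card (?R \<union> residue q ` (?I - A))" using finA by (intro card_mono) auto
    also have "\<dots> \<le> card ?R + card (residue q ` (?I - A))" by (rule card_Un_le)
    also have "card (residue q ` (?I - A)) \<le> card (?I - A)" by (rule card_image_le) simp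
    finally show ?thesis using cI cK unfolding G_def by simp
  qed
  have "t \<le> reps (residue q ` A0) (residue q ` B0) g" if g: "g \<in> F" for g
  proof -
    let ?Y = "(\<lambda>b. g - b) ` residue q ` B0"
    have "?Y \<subseteq> G"
    proof
      fix h assume "h \<in> ?Y"
      then obtain y where y: "y \<in> B0" "h = g - residue q y" by blast
      obtain l where l: "y - Min B = step * l" using step_dvd(2) sub0 y(1) by (meson dvdE subsetD)
      obtain k :: nat where k: "g = residue q (Min A + Min B + step * int k)"
        using g unfolding F_def by (auto simp: residue_add)
      have "h = residue q ((Min A + Min B + step * int k) - y)" using k y(2) by (simp add: residue_diff)
      also have "(Min A + Min B + step * int k) - y = Min A + step * (int k - l)"
        using l by (simp add: algebra_simps)
      finally show "h \<in> G" using GK[OF K] by (simp add: residue_add)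
    qed
    then have "card (?R \<union> ?Y) \<le> card G" using RG unfolding G_def by (intro card_mono) auto
    moreover have "card ?R + card ?Y = card (?R \<union> ?Y) + card (?R \<inter> ?Y)"
      by (rule card_Un_Int) (use finA finB B0_def in auto)
    moreover have "card ?Y = card B0"
      using injB by (simp add: card_image inj_on_def image_image)
    moreover have "card G = c" unfolding G_def by (rule cK)
    ultimately have "card ?R + card B0 \<le> c + card (?R \<inter> ?Y)" by simp
    moreover have "card (?R \<inter> ?Y) \<le> reps ?R (residue q ` B0) g"
      unfolding reps_def
      by (rule card_inj_on_le[of "\<lambda>h. (h, g - h)"]) (use finA finB B0_def in \<open>auto simp: inj_on_def\<close>)
    ultimately have "card B0 + card A \<le> a + 1 + reps ?R (residue q ` B0) g" using cR by linarith
    then have "real (card B0) + real (card A) \<le> real a + 1 + real (reps ?R (residue q ` B0) g)" by linarith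
    \<comment> \<open>The number of representations is at least \<open>v - r - 7 * w - 1\<close>,
      which exceeds \<open>w + 1\<close> because \<open>r < v / 2 - 13 * w\<close>.\<close>
    then have "real t \<le> real (reps ?R (residue q ` B0) g)"
      using a t cB0 cardA cardB r_lt large w2 by linarith
    then show ?thesis using A0(3) by simp
  qed
  then have "real (card F) \<le> real (card ?S) + w"
    by (intro popular_residues[OF A0(1) sub0 A0(2) injB _ _ t(2)]) (auto simp: F_def)
  then have "real c + 1 \<le> v + r + 5 * w"
    using card_sumset_ge_short cF cardS cardA w2 unfolding q_def by linarith
  then show ?thesis unfolding c_def q_def by linarith
qed


section \<open>Symmetry and the covering progressions\<close>

lemma swap: "dense_sum_graph B A (\<Gamma>\<inverse>) v u r w"
proof
  have "restricted_sumset (\<Gamma>\<inverse>) = restricted_sumset \<Gamma>"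
    unfolding restricted_sumset_def by (auto simp: add.commute; metis add.commute)
  then show "real (card (restricted_sumset (\<Gamma>\<inverse>))) \<le> v + u + r" using cardS by (simp add: add.commute)
  have "B \<times> A - \<Gamma>\<inverse> = (A \<times> B - \<Gamma>)\<inverse>" by auto
  then show "real (card (B \<times> A - \<Gamma>\<inverse>)) \<le> w * w" using total by simp
qed (use finA finB sub row col cardA cardB r_lt w2 nonempty in auto)

lemma progressions_of_diameter_le:
  assumes "Max B - Min B \<le> Max A - Min A"
  shows "\<exists>d P Q. arith_progression d P \<and> arith_progression d Q \<and> A \<subseteq> P \<and> B \<subseteq> Q \<and> finite P \<and> finite Q
    \<and> real (card P) \<le> u + r + 5 * w \<and> real (card Q) \<le> v + r + 5 * w"
proof -
  have ap: "arith_progression d ((\<lambda>k. z + int k * d) ` {..n})" if "d > 0" for d z n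
    unfolding arith_progression_def
    using that by (intro conjI exI[of _ z] exI[of _ "Suc n"]) (auto simp: less_Suc_eq_le)
  have len: "real (card ((\<lambda>k. z + int k * d) ` {..nat (D div d)})) \<le> real_of_int (D div d) + 1"
    if "d > 0" "D > 0" for d z D :: int
  proof -
    have "card ((\<lambda>k. z + int k * d) ` {..nat (D div d)}) \<le> nat (D div d) + 1"
      using card_image_le[of "{..nat (D div d)}"] by simp
    moreover have "D div d \<ge> 0" using that by (simp add: pos_imp_zdiv_nonneg_iff)
    ultimately show ?thesis by linarith
  qed
  let ?P = "\<lambda>X. (\<lambda>k. Min X + int k * step) ` {..nat ((Max X - Min X) div step)}"
  have "real (card (?P A)) \<le> u + r + 5 * w" "real (card (?P B)) \<le> v + r + 5 * w"
    using len[OF step_pos, of "Max A - Min A" "Min A"] len[OF step_pos, of "Max B - Min B" "Min B"]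
      Min_less_Max long_side_length[OF assms] short_side_length[OF assms] by linarith+
  then show ?thesis
    using ap[OF step_pos] subset_progression[OF finA step_pos step_dvd(1)]
      subset_progression[OF finB step_pos step_dvd(2)]
    by (intro exI[of _ step] exI[of _ "?P A"] exI[of _ "?P B"]) auto
qed

lemma progressions:
  "\<exists>d P Q. arith_progression d P \<and> arith_progression d Q \<and> A \<subseteq> P \<and> B \<subseteq> Q \<and> finite P \<and> finite Q
    \<and> real (card P) \<le> u + r + 5 * w \<and> real (card Q) \<le> v + r + 5 * w"
proof (cases "Max B - Min B \<le> Max A - Min A")
  case True
  then show ?thesis by (rule progressions_of_diameter_le)
next
  case False
  then show ?thesis using dense_sum_graph.progressions_of_diameter_le[OF swap] by (meson nle_le)
qed

end

section \<open>Deleting vertices of low degree\<close>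

text \<open>Markov's inequality: each deleted vertex has more than \<open>\<delta> * card Y\<close>
  non-neighbours, out of \<open>\<delta> * \<delta> * card X * card Y\<close> non-edges.\<close>

lemma card_high_degree:
  fixes \<delta> :: real
  assumes "finite X" "finite Y" "Y \<noteq> {}" "\<delta> > 0"
    and "real (card (X \<times> Y - G)) \<le> \<delta> * \<delta> * real (card X) * real (card Y)"
  shows "(1 - \<delta>) * real (card X) \<le> real (card {x \<in> X. real (card {y \<in> Y. (x, y) \<notin> G}) \<le> \<delta> * real (card Y)})"
proof -
  let ?d = "\<lambda>x. card {y \<in> Y. (x, y) \<notin> G}"
  let ?X' = "{x \<in> X. real (?d x) \<le> \<delta> * real (card Y)}"
  have "real (card (X - ?X')) * (\<delta> * real (card Y)) = (\<Sum>x\<in>X - ?X'. \<delta> * real (card Y))" by simp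
  also have "\<dots> \<le> (\<Sum>x\<in>X - ?X'. real (?d x))" by (rule sum_mono) auto
  also have "\<dots> \<le> (\<Sum>x\<in>X. real (?d x))" by (rule sum_mono2) (use assms(1) in auto)
  also have "\<dots> = real (card (SIGMA x:X. {y \<in> Y. (x, y) \<notin> G}))"
    using assms(1,2) by (subst card_SigmaI) auto
  also have "(SIGMA x:X. {y \<in> Y. (x, y) \<notin> G}) = X \<times> Y - G" by auto
  also have "real (card (X \<times> Y - G)) \<le> (\<delta> * real (card X)) * (\<delta> * real (card Y))"
    using assms(5) by (simp add: mult_ac)
  finally have "real (card (X - ?X')) * (\<delta> * real (card Y)) \<le> (\<delta> * real (card X)) * (\<delta> * real (card Y))" .
  moreover have "\<delta> * real (card Y) > 0" using assms(2-4) by (simp add: card_gt_0_iff)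
  ultimately have "real (card (X - ?X')) \<le> \<delta> * real (card X)" by (rule mult_right_le_imp_le)
  moreover have "card (X - ?X') = card X - card ?X'" using assms(1) by (intro card_Diff_subset) auto
  moreover have "card ?X' \<le> card X" using assms(1) by (intro card_mono) auto
  ultimately show ?thesis by (simp add: left_diff_distrib of_nat_diff)
qed

theorem theorem3p3:
  fixes \<epsilon> :: real and U V :: "int set" and \<Gamma> :: "(int \<times> int) set"
    and N M :: nat and r :: int
  assumes "0 < \<epsilon>" and "\<epsilon> < 1 / 2"
    and "finite U" and "finite V"
    and "N = min (card U) (card V)" and "N \<ge> 3"
    and "M = max (card U) (card V)" and "real M \<ge> 2 / sqrt \<epsilon>"
    and "\<Gamma> \<subseteq> U \<times> V"
    and "real (card \<Gamma>) \<ge> (1 - \<epsilon>) * real (card U) * real (card V)"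
    and "int (card (restricted_sumset \<Gamma>)) = int (card U) + int (card V) + r"
    and "real_of_int r < real N / 2 - 13 * sqrt \<epsilon> * real M"
  shows "\<exists>(d::int) P Q. arith_progression d P \<and> arith_progression d Q
    \<and> real (card P) \<le> real (card U) + real_of_int r + 5 * sqrt \<epsilon> * real M
    \<and> real (card Q) \<le> real (card V) + real_of_int r + 5 * sqrt \<epsilon> * real M
    \<and> real (card (P \<inter> U)) \<ge> (1 - sqrt \<epsilon>) * real (card U)
    \<and> real (card (Q \<inter> V)) \<ge> (1 - sqrt \<epsilon>) * real (card V)"
proof -
  define \<delta> where "\<delta> = sqrt \<epsilon>"
  have \<delta>: "\<delta> > 0" "\<delta> < 1" "\<delta> * \<delta> = \<epsilon>" unfolding \<delta>_def using assms(1,2) by auto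
  define w where "w = \<delta> * real M"
  \<comment> \<open>This is the hypothesis \<open>M \<ge> 2 / sqrt \<epsilon>\<close>
    rewritten.\<close>
  have w2: "2 \<le> w" using assms(8) \<delta>(1) unfolding w_def \<delta>_def[symmetric] by (simp add: field_simps)
  have "card U \<ge> 3" "card V \<ge> 3" using assms(5,6) by auto
  then have ne: "U \<noteq> {}" "V \<noteq> {}" by auto
  have Uw: "\<delta> * real (card U) \<le> w" and Vw: "\<delta> * real (card V) \<le> w"
    unfolding w_def assms(7) using \<delta>(1) by auto
  have "card (U \<times> V - \<Gamma>) = card U * card V - card \<Gamma>"
    using assms(3,4,9) by (subst card_Diff_subset) (auto intro: finite_subset simp: card_cartesian_product)
  moreover have "card \<Gamma> \<le> card U * card V"
    using card_mono[OF _ assms(9)] assms(3,4) by (simp add: card_cartesian_product)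
  ultimately have "real (card (U \<times> V - \<Gamma>)) = real (card U) * real (card V) - real (card \<Gamma>)"
    by (simp add: of_nat_diff)
  then have miss: "real (card (U \<times> V - \<Gamma>)) \<le> \<delta> * \<delta> * real (card U) * real (card V)"
    using assms(10) \<delta>(3) by (simp add: algebra_simps)
  define U' where "U' = {x \<in> U. real (card {y \<in> V. (x, y) \<notin> \<Gamma>}) \<le> \<delta> * real (card V)}"
  define V' where "V' = {y \<in> V. real (card {x \<in> U. (y, x) \<notin> \<Gamma>\<inverse>}) \<le> \<delta> * real (card U)}"
  have cU': "(1 - \<delta>) * real (card U) \<le> real (card U')"
    unfolding U'_def by (rule card_high_degree[OF assms(3,4) ne(2) \<delta>(1) miss])
  have "V \<times> U - \<Gamma>\<inverse> = (U \<times> V - \<Gamma>)\<inverse>" by auto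
  then have "real (card (V \<times> U - \<Gamma>\<inverse>)) \<le> \<delta> * \<delta> * real (card V) * real (card U)"
    using miss by (simp add: mult_ac)
  then have cV': "(1 - \<delta>) * real (card V) \<le> real (card V')"
    unfolding V'_def by (rule card_high_degree[OF assms(4,3) ne(1) \<delta>(1)])
  have subUV: "U' \<subseteq> U" "V' \<subseteq> V" unfolding U'_def V'_def by auto
  have pos: "0 < (1 - \<delta>) * real (card U)" "0 < (1 - \<delta>) * real (card V)"
    using \<delta> ne assms(3,4) by (auto simp: card_gt_0_iff)
  let ?G = "\<Gamma> \<inter> U' \<times> V'"
  \<comment> \<open>\<open>u\<close> and \<open>v\<close> stay the cardinalities of the full sets,
    so the resulting lengths are already the required ones; restricting to \<open>U'\<close> and
    \<open>V'\<close> only removes sums.\<close>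
  interpret dense_sum_graph U' V' ?G "real (card U)" "real (card V)" "real_of_int r" w
  proof
    show "finite U'" "finite V'" using subUV assms(3,4) by (auto intro: finite_subset)
    show "U' \<noteq> {}" "V' \<noteq> {}" using cU' cV' pos by auto
    show "real (card U) - w \<le> real (card U')" using cU' Uw by (simp add: algebra_simps)
    show "real (card V) - w \<le> real (card V')" using cV' Vw by (simp add: algebra_simps)
    show "real_of_int r < real (card U) / 2 - 13 * w" "real_of_int r < real (card V) / 2 - 13 * w"
      using assms(12) unfolding w_def \<delta>_def assms(5) by auto
    show "2 \<le> w" by (rule w2)
    show "real (card {y \<in> V'. (x, y) \<notin> ?G}) \<le> w" if "x \<in> U'" for x
    proof -
      have "card {y \<in> V'. (x, y) \<notin> ?G} \<le> card {y \<in> V. (x, y) \<notin> \<Gamma>}"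
        using that subUV assms(4) by (intro card_mono) auto
      then show ?thesis using that Vw unfolding U'_def by auto
    qed
    show "real (card {x \<in> U'. (x, y) \<notin> ?G}) \<le> w" if "y \<in> V'" for y
    proof -
      have "card {x \<in> U'. (x, y) \<notin> ?G} \<le> card {x \<in> U. (y, x) \<notin> \<Gamma>\<inverse>}"
        using that subUV assms(3) by (intro card_mono) auto
      moreover have "real (card {x \<in> U. (y, x) \<notin> \<Gamma>\<inverse>}) \<le> \<delta> * real (card U)"
        using that unfolding V'_def by blast
      ultimately show ?thesis using Uw by linarith
    qed
    have "card (U' \<times> V' - ?G) \<le> card (U \<times> V - \<Gamma>)"
      using subUV assms(3,4) by (intro card_mono) auto
    then have "real (card (U' \<times> V' - ?G)) \<le> (\<delta> * real (card U)) * (\<delta> * real (card V))"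
      using miss by (simp add: mult_ac)
    also have "\<dots> \<le> w * w" using Uw Vw \<delta>(1) w2 by (intro mult_mono) auto
    finally show "real (card (U' \<times> V' - ?G)) \<le> w * w" .
    have "finite (restricted_sumset \<Gamma>)"
      using finite_subset[OF assms(9)] assms(3,4) by (intro finite_restricted_sumset) simp
    then have "card (restricted_sumset ?G) \<le> card (restricted_sumset \<Gamma>)"
      by (rule card_mono) (auto simp: restricted_sumset_def)
    then show "real (card (restricted_sumset ?G)) \<le> real (card U) + real (card V) + real_of_int r"
      using assms(11) by linarith
  qed auto
  obtain d P Q where PQ: "arith_progression d P" "arith_progression d Q" "U' \<subseteq> P" "V' \<subseteq> Q"
    "finite P" "finite Q" "real (card P) \<le> real (card U) + real_of_int r + 5 * w"
    "real (card Q) \<le> real (card V) + real_of_int r + 5 * w"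
    using progressions by blast
  have "card U' \<le> card (P \<inter> U)" "card V' \<le> card (Q \<inter> V)"
    using PQ subUV by (auto intro!: card_mono)
  then show ?thesis using PQ cU' cV' unfolding w_def \<delta>_def
    by (intro exI[of _ d] exI[of _ P] exI[of _ Q]) (auto simp: mult.assoc)
qed

end
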